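(* Let $R$ be a ring and let $(\mathcal{W},\mathcal{F})$ be a cotorsion pair in the category $R$-Mod of $R$-modules such that $\mathcal{W}$ is thick. Then $\mathcal{W}$ is closed under direct limits.
   Context: A pair of classes $(\mathcal{W},\mathcal{F})$ in an abelian category $\mathcal{A}$ is a cotorsion pair if $\mathcal{F}=\{Y:\operatorname{Ext}^1_{\mathcal{A}}(W,Y)=0\ \forall W\in\mathcal{W}\}$ and $\mathcal{W}=\{X:\operatorname{Ext}^1_{\mathcal{A}}(X,F)=0\ \forall F\in\mathcal{F}\}$. The class $\mathcal{W}$ is thick if it satisfies the two out of three property on short exact sequences: whenever two of the three terms of a short exact sequence lie in $\mathcal{W}$, so does the third. Direct limits are colimits of systems indexed by directed posets. No completeness of the cotorsion pair is assumed. *)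

theory Defs
  imports "HOL-Algebra.Module" "HOL-Algebra.AbelCoset" "HOL-Library.Equipollence"
begin

text \<open>
  HOL has no proper classes, so \<open>R\<close>-Mod is the category of all \<open>R\<close>-modules whose carrier is a
  small subset of a type \<^typ>\<open>'u\<close>. Smallness is an arbitrary predicate closed under separation,
  replacement and small unions. The small sets of a model of ZFC and the members of an uncountable
  Grothendieck universe satisfy these axioms. Closure under power sets is not required, so the
  axioms can also be satisfied without any large cardinal.
\<close>

locale smallness =
  fixes small :: "'u set \<Rightarrow> bool"
  assumes small_subset: "\<lbrakk>small A; B \<subseteq> A\<rbrakk> \<Longrightarrow> small B"
    and small_image: "\<And>h :: 'u \<Rightarrow> 'u. small A \<Longrightarrow> small (h ` A)"
    and small_Union: "\<And>(J :: 'u set) A. \<lbrakk>small J; \<And>j. j \<in> J \<Longrightarrow> small (A j)\<rbrakk> \<Longrightarrow> small (\<Union>j\<in>J. A j)"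
    and small_infinite: "\<exists>A. small A \<and> infinite A"

lemma smallness_all:
  assumes "infinite (UNIV :: 'u set)"
  shows "smallness (\<lambda>A :: 'u set. True)"
  using assms by unfold_locales auto

definition of_small_size :: "('u set \<Rightarrow> bool) \<Rightarrow> 'a set \<Rightarrow> bool" where
  "of_small_size small A \<longleftrightarrow> (\<exists>B. small B \<and> A \<approx> B)"

text \<open>
  The locale \<^locale>\<open>module\<close> requires a commutative ring. The \<open>mult\<close> and \<open>one\<close> fields of a module
  record carry no meaning, as in HOL-Algebra.
\<close>

locale left_module = R?: ring R + M?: abelian_group M
  for R :: "'r ring" (structure) and M :: "('r, 'a) module" (structure) +
  assumes smult_closed: "\<lbrakk>a \<in> carrier R; x \<in> carrier M\<rbrakk> \<Longrightarrow> a \<odot>\<^bsub>M\<^esub> x \<in> carrier M"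
    and smult_l_distr: "\<lbrakk>a \<in> carrier R; b \<in> carrier R; x \<in> carrier M\<rbrakk> \<Longrightarrow>
      (a \<oplus>\<^bsub>R\<^esub> b) \<odot>\<^bsub>M\<^esub> x = a \<odot>\<^bsub>M\<^esub> x \<oplus>\<^bsub>M\<^esub> b \<odot>\<^bsub>M\<^esub> x"
    and smult_r_distr: "\<lbrakk>a \<in> carrier R; x \<in> carrier M; y \<in> carrier M\<rbrakk> \<Longrightarrow>
      a \<odot>\<^bsub>M\<^esub> (x \<oplus>\<^bsub>M\<^esub> y) = a \<odot>\<^bsub>M\<^esub> x \<oplus>\<^bsub>M\<^esub> a \<odot>\<^bsub>M\<^esub> y"
    and smult_assoc: "\<lbrakk>a \<in> carrier R; b \<in> carrier R; x \<in> carrier M\<rbrakk> \<Longrightarrow>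
      (a \<otimes>\<^bsub>R\<^esub> b) \<odot>\<^bsub>M\<^esub> x = a \<odot>\<^bsub>M\<^esub> (b \<odot>\<^bsub>M\<^esub> x)"
    and smult_one: "x \<in> carrier M \<Longrightarrow> \<one>\<^bsub>R\<^esub> \<odot>\<^bsub>M\<^esub> x = x"

definition RMod :: "('u set \<Rightarrow> bool) \<Rightarrow> 'r ring \<Rightarrow> ('r, 'u) module set" where
  "RMod small R = {M. left_module R M \<and> small (carrier M)}"

definition mod_hom :: "'r ring \<Rightarrow> ('r, 'a) module \<Rightarrow> ('r, 'b) module \<Rightarrow> ('a \<Rightarrow> 'b) set" where
  "mod_hom R M N = {f \<in> hom (add_monoid M) (add_monoid N).
     \<forall>r\<in>carrier R. \<forall>x\<in>carrier M. f (r \<odot>\<^bsub>M\<^esub> x) = r \<odot>\<^bsub>N\<^esub> f x}"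

definition short_exact :: "'r ring \<Rightarrow> ('r, 'a) module \<Rightarrow> ('a \<Rightarrow> 'b) \<Rightarrow> ('r, 'b) module \<Rightarrow>
    ('b \<Rightarrow> 'c) \<Rightarrow> ('r, 'c) module \<Rightarrow> bool" where
  "short_exact R A f B g C \<longleftrightarrow>
     f \<in> mod_hom R A B \<and> g \<in> mod_hom R B C \<and>
     inj_on f (carrier A) \<and> f ` carrier A = a_kernel B C g \<and> g ` carrier B = carrier C"

definition mod_dsum :: "('r, 'a) module \<Rightarrow> ('r, 'b) module \<Rightarrow> ('r, 'a \<times> 'b) module" where
  "mod_dsum M N = \<lparr>carrier = carrier M \<times> carrier N, monoid.mult = undefined, monoid.one = undefined,
     ring.zero = (\<zero>\<^bsub>M\<^esub>, \<zero>\<^bsub>N\<^esub>), ring.add = (\<lambda>(x, y) (x', y'). (x \<oplus>\<^bsub>M\<^esub> x', y \<oplus>\<^bsub>N\<^esub> y')),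
     module.smult = (\<lambda>r (x, y). (r \<odot>\<^bsub>M\<^esub> x, r \<odot>\<^bsub>N\<^esub> y))\<rparr>"

text \<open>
  \<open>Ext1 small R X Y\<close> is the underlying set of the Yoneda group \<open>Ext\<^sup>1(X, Y)\<close>: extensions
  \<open>0 \<rightarrow> Y \<rightarrow> E \<rightarrow> X \<rightarrow> 0\<close> modulo morphisms that are the identity on \<open>Y\<close> and \<open>X\<close>. Such a morphism
  is an isomorphism by the five lemma, so the relation is symmetric. The zero of the group is the
  class of the split extension, whose middle term lives in \<^typ>\<open>'u \<times> 'u\<close>; for this reason
  \<open>ext_equiv\<close> allows middle terms of different types.
\<close>

type_synonym ('r, 'y, 'e, 'x) extension = "('y \<Rightarrow> 'e) \<times> ('r, 'e) module \<times> ('e \<Rightarrow> 'x)"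

definition extensions :: "('u set \<Rightarrow> bool) \<Rightarrow> 'r ring \<Rightarrow> ('r, 'u) module \<Rightarrow> ('r, 'u) module \<Rightarrow>
    ('r, 'u, 'u, 'u) extension set" where
  "extensions small R X Y = {(f, E, g). E \<in> RMod small R \<and> short_exact R Y f E g X}"

fun ext_equiv :: "'r ring \<Rightarrow> ('r, 'y) module \<Rightarrow> ('r, 'y, 'e, 'x) extension \<Rightarrow>
    ('r, 'y, 'd, 'x) extension \<Rightarrow> bool" where
  "ext_equiv R Y (f, E, g) (f', E', g') \<longleftrightarrow>
     (\<exists>h\<in>mod_hom R E E'. (\<forall>y\<in>carrier Y. h (f y) = f' y) \<and> (\<forall>e\<in>carrier E. g' (h e) = g e))"

definition split_ext :: "('r, 'x) module \<Rightarrow> ('r, 'y) module \<Rightarrow>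
    ('r, 'y, 'y \<times> 'x, 'x) extension" where
  "split_ext X Y = ((\<lambda>y. (y, \<zero>\<^bsub>X\<^esub>)), mod_dsum Y X, snd)"

definition Ext1 :: "('u set \<Rightarrow> bool) \<Rightarrow> 'r ring \<Rightarrow> ('r, 'u) module \<Rightarrow> ('r, 'u) module \<Rightarrow>
    ('r, 'u, 'u, 'u) extension set set" where
  "Ext1 small R X Y = extensions small R X Y //
     {(\<xi>, \<zeta>). \<xi> \<in> extensions small R X Y \<and> \<zeta> \<in> extensions small R X Y \<and> ext_equiv R Y \<xi> \<zeta>}"

definition Ext1_zero :: "('u set \<Rightarrow> bool) \<Rightarrow> 'r ring \<Rightarrow> ('r, 'u) module \<Rightarrow> ('r, 'u) module \<Rightarrow>
    ('r, 'u, 'u, 'u) extension set" where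
  "Ext1_zero small R X Y = {\<xi> \<in> extensions small R X Y. ext_equiv R Y \<xi> (split_ext X Y)}"

definition Ext1_vanishes :: "('u set \<Rightarrow> bool) \<Rightarrow> 'r ring \<Rightarrow> ('r, 'u) module \<Rightarrow> ('r, 'u) module \<Rightarrow>
    bool" where
  "Ext1_vanishes small R X Y \<longleftrightarrow> Ext1 small R X Y = {Ext1_zero small R X Y}"

definition cotorsion_pair :: "('u set \<Rightarrow> bool) \<Rightarrow> 'r ring \<Rightarrow> ('r, 'u) module set \<Rightarrow>
    ('r, 'u) module set \<Rightarrow> bool" where
  "cotorsion_pair small R \<W> \<F> \<longleftrightarrow>
     \<F> = {Y \<in> RMod small R. \<forall>W\<in>\<W>. Ext1_vanishes small R W Y} \<and>
     \<W> = {X \<in> RMod small R. \<forall>F\<in>\<F>. Ext1_vanishes small R X F}"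

definition thick :: "('u set \<Rightarrow> bool) \<Rightarrow> 'r ring \<Rightarrow> ('r, 'u) module set \<Rightarrow> bool" where
  "thick small R \<W> \<longleftrightarrow>
     (\<forall>A\<in>RMod small R. \<forall>B\<in>RMod small R. \<forall>C\<in>RMod small R. \<forall>f g. short_exact R A f B g C \<longrightarrow>
        (A \<in> \<W> \<and> B \<in> \<W> \<longrightarrow> C \<in> \<W>) \<and>
        (A \<in> \<W> \<and> C \<in> \<W> \<longrightarrow> B \<in> \<W>) \<and>
        (B \<in> \<W> \<and> C \<in> \<W> \<longrightarrow> A \<in> \<W>))"

definition directed_poset :: "'i set \<Rightarrow> 'i rel \<Rightarrow> bool" where
  "directed_poset I r \<longleftrightarrow> partial_order_on I r \<and> I \<noteq> {} \<and>
     (\<forall>i\<in>I. \<forall>j\<in>I. \<exists>k\<in>I. (i, k) \<in> r \<and> (j, k) \<in> r)"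

definition direct_system :: "('u set \<Rightarrow> bool) \<Rightarrow> 'r ring \<Rightarrow> 'i set \<Rightarrow> 'i rel \<Rightarrow>
    ('i \<Rightarrow> ('r, 'u) module) \<Rightarrow> ('i \<Rightarrow> 'i \<Rightarrow> 'u \<Rightarrow> 'u) \<Rightarrow> bool" where
  "direct_system small R I r M t \<longleftrightarrow>
     (\<forall>i\<in>I. M i \<in> RMod small R) \<and>
     (\<forall>(i, j)\<in>r. t i j \<in> mod_hom R (M i) (M j)) \<and>
     (\<forall>i\<in>I. \<forall>x\<in>carrier (M i). t i i x = x) \<and>
     (\<forall>i j k. (i, j) \<in> r \<and> (j, k) \<in> r \<longrightarrow> (\<forall>x\<in>carrier (M i). t j k (t i j x) = t i k x))"

definition cocone :: "('u set \<Rightarrow> bool) \<Rightarrow> 'r ring \<Rightarrow> 'i set \<Rightarrow> 'i rel \<Rightarrow>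
    ('i \<Rightarrow> ('r, 'u) module) \<Rightarrow> ('i \<Rightarrow> 'i \<Rightarrow> 'u \<Rightarrow> 'u) \<Rightarrow>
    ('r, 'u) module \<Rightarrow> ('i \<Rightarrow> 'u \<Rightarrow> 'u) \<Rightarrow> bool" where
  "cocone small R I r M t N c \<longleftrightarrow>
     N \<in> RMod small R \<and>
     (\<forall>i\<in>I. c i \<in> mod_hom R (M i) N) \<and>
     (\<forall>(i, j)\<in>r. \<forall>x\<in>carrier (M i). c j (t i j x) = c i x)"

text \<open>Homomorphisms are unconstrained outside the carrier, hence uniqueness only up to agreement
  on the carrier.\<close>

definition is_colimit :: "('u set \<Rightarrow> bool) \<Rightarrow> 'r ring \<Rightarrow> 'i set \<Rightarrow> 'i rel \<Rightarrow>
    ('i \<Rightarrow> ('r, 'u) module) \<Rightarrow> ('i \<Rightarrow> 'i \<Rightarrow> 'u \<Rightarrow> 'u) \<Rightarrow>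
    ('r, 'u) module \<Rightarrow> ('i \<Rightarrow> 'u \<Rightarrow> 'u) \<Rightarrow> bool" where
  "is_colimit small R I r M t L l \<longleftrightarrow>
     cocone small R I r M t L l \<and>
     (\<forall>N c. cocone small R I r M t N c \<longrightarrow>
        (\<exists>h\<in>mod_hom R L N. (\<forall>i\<in>I. \<forall>x\<in>carrier (M i). h (l i x) = c i x) \<and>
           (\<forall>h'\<in>mod_hom R L N. (\<forall>i\<in>I. \<forall>x\<in>carrier (M i). h' (l i x) = c i x) \<longrightarrow>
              (\<forall>y\<in>carrier L. h' y = h y))))"

end

theory Submission
  imports Defs
begin

text \<open>
  Choose upper bounds \<open>u F\<close> of the finite subsets \<open>F\<close> of the index set \<open>I\<close>, monotonically in \<open>F\<close>. The
  direct limit is then a limit over the finite subsets of \<open>I\<close>. For \<open>B \<subseteq> I\<close> let \<open>K B\<close> be the kernel of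
  the map from \<open>\<Oplus>\<^sub>F M (u F)\<close>, \<open>F\<close> ranging over the finite subsets of \<open>B\<close>, to the direct limit of these
  modules. If \<open>B\<close> is finite, this limit is \<open>M (u B)\<close>, and \<open>K B\<close> lies in the left class by thickness.
  If \<open>B\<close> is infinite, \<open>K B\<close> is the union of the continuous chain of all \<open>K C\<close> with \<open>C\<close> a proper initial
  segment of a well-order of \<open>B\<close> of minimal length. By induction on the cardinality each \<open>K C\<close> lies in
  the left class, by thickness so do the successive quotients, and by Eklof's lemma so does \<open>K B\<close>.
  Thickness, applied to \<open>0 \<rightarrow> K I \<rightarrow> \<Oplus>\<^sub>F M (u F) \<rightarrow> L \<rightarrow> 0\<close>, finishes the proof.
\<close>

section \<open>Left modules\<close>

text \<open>Eklof's lemma needs a chain of submodules. The limits over \<open>Fpow C\<close> for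
  growing \<open>C\<close> do not form one, since the maps between them need not be injective. Their
  kernels do: every \<open>K C\<close> is a submodule of the same direct sum \<open>D\<close>.
  Finite subsets make every \<open>C\<close> usable: a subset of a directed poset need not be
  directed, but \<open>Fpow C\<close> always is. A finite subset of the union of a chain lies in one
  member, so \<open>K\<close> is continuous.

  A step of the filtration leads from \<open>underS r a\<close> to \<open>under r a\<close>. Both
  must have smaller cardinality than \<open>B\<close> for the induction to reach them, hence the
  minimal length of \<open>r\<close>. The quotient of the two kernels is the cokernel of a
  monomorphism in the left class, which closure under extensions alone would not control.

  A further constraint is one of types: the elements of \<open>D\<close> are functions, while
  thickness and the universal property of \<open>L\<close> speak of modules on \<open>'u\<close>.
  Membership in the left class is therefore replaced by an orthogonality that makes sense on every
  type and is invariant under isomorphism.\<close>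

lemma left_moduleI:
  fixes R :: "'r ring" and M :: "('r, 'a) module"
  assumes "ring R"
    and "\<And>x y. \<lbrakk>x \<in> carrier M; y \<in> carrier M\<rbrakk> \<Longrightarrow> x \<oplus>\<^bsub>M\<^esub> y \<in> carrier M"
    and "\<zero>\<^bsub>M\<^esub> \<in> carrier M"
    and "\<And>x y z. \<lbrakk>x \<in> carrier M; y \<in> carrier M; z \<in> carrier M\<rbrakk> \<Longrightarrow>
      x \<oplus>\<^bsub>M\<^esub> y \<oplus>\<^bsub>M\<^esub> z = x \<oplus>\<^bsub>M\<^esub> (y \<oplus>\<^bsub>M\<^esub> z)"
    and "\<And>x y. \<lbrakk>x \<in> carrier M; y \<in> carrier M\<rbrakk> \<Longrightarrow> x \<oplus>\<^bsub>M\<^esub> y = y \<oplus>\<^bsub>M\<^esub> x"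
    and "\<And>x. x \<in> carrier M \<Longrightarrow> \<zero>\<^bsub>M\<^esub> \<oplus>\<^bsub>M\<^esub> x = x"
    and "\<And>x. x \<in> carrier M \<Longrightarrow> \<exists>y\<in>carrier M. y \<oplus>\<^bsub>M\<^esub> x = \<zero>\<^bsub>M\<^esub>"
    and "\<And>a x. \<lbrakk>a \<in> carrier R; x \<in> carrier M\<rbrakk> \<Longrightarrow> a \<odot>\<^bsub>M\<^esub> x \<in> carrier M"
    and "\<And>a b x. \<lbrakk>a \<in> carrier R; b \<in> carrier R; x \<in> carrier M\<rbrakk> \<Longrightarrow>
      (a \<oplus>\<^bsub>R\<^esub> b) \<odot>\<^bsub>M\<^esub> x = a \<odot>\<^bsub>M\<^esub> x \<oplus>\<^bsub>M\<^esub> b \<odot>\<^bsub>M\<^esub> x"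
    and "\<And>a x y. \<lbrakk>a \<in> carrier R; x \<in> carrier M; y \<in> carrier M\<rbrakk> \<Longrightarrow>
      a \<odot>\<^bsub>M\<^esub> (x \<oplus>\<^bsub>M\<^esub> y) = a \<odot>\<^bsub>M\<^esub> x \<oplus>\<^bsub>M\<^esub> a \<odot>\<^bsub>M\<^esub> y"
    and "\<And>a b x. \<lbrakk>a \<in> carrier R; b \<in> carrier R; x \<in> carrier M\<rbrakk> \<Longrightarrow>
      (a \<otimes>\<^bsub>R\<^esub> b) \<odot>\<^bsub>M\<^esub> x = a \<odot>\<^bsub>M\<^esub> (b \<odot>\<^bsub>M\<^esub> x)"
    and "\<And>x. x \<in> carrier M \<Longrightarrow> \<one>\<^bsub>R\<^esub> \<odot>\<^bsub>M\<^esub> x = x"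
  shows "left_module R M"
  using assms by (intro left_module.intro abelian_groupI left_module_axioms.intro) auto

lemma (in left_module) zero_smult:
  assumes "x \<in> carrier M" shows "\<zero> \<odot>\<^bsub>M\<^esub> x = \<zero>\<^bsub>M\<^esub>"
proof -
  have "\<zero> \<odot>\<^bsub>M\<^esub> x \<oplus>\<^bsub>M\<^esub> \<zero> \<odot>\<^bsub>M\<^esub> x = \<zero> \<odot>\<^bsub>M\<^esub> x"
    using smult_l_distr[of \<zero> \<zero> x] assms by simp
  then show ?thesis
    using assms smult_closed M.add.l_cancel_one R.zero_closed by metis
qed

lemma (in left_module) smult_zero:
  assumes "a \<in> carrier R" shows "a \<odot>\<^bsub>M\<^esub> \<zero>\<^bsub>M\<^esub> = \<zero>\<^bsub>M\<^esub>"
proof -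
  have "a \<odot>\<^bsub>M\<^esub> \<zero>\<^bsub>M\<^esub> \<oplus>\<^bsub>M\<^esub> a \<odot>\<^bsub>M\<^esub> \<zero>\<^bsub>M\<^esub> = a \<odot>\<^bsub>M\<^esub> \<zero>\<^bsub>M\<^esub>"
    using smult_r_distr[of a "\<zero>\<^bsub>M\<^esub>" "\<zero>\<^bsub>M\<^esub>"] assms by simp
  then show ?thesis
    using assms smult_closed M.add.l_cancel_one M.zero_closed by metis
qed

lemma (in left_module) smult_minus_one:
  assumes "x \<in> carrier M" shows "(\<ominus> \<one>) \<odot>\<^bsub>M\<^esub> x = \<ominus>\<^bsub>M\<^esub> x"
proof -
  have "(\<ominus> \<one>) \<odot>\<^bsub>M\<^esub> x \<oplus>\<^bsub>M\<^esub> x = \<zero>\<^bsub>M\<^esub>"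
    using smult_l_distr[of "\<ominus> \<one>" \<one> x] assms
    by (simp add: smult_one zero_smult R.l_neg)
  then show ?thesis
    using assms smult_closed M.minus_equality by (metis R.add.inv_closed R.one_closed)
qed

lemma (in left_module) smult_minus:
  assumes "a \<in> carrier R" "x \<in> carrier M" "y \<in> carrier M"
  shows "a \<odot>\<^bsub>M\<^esub> (x \<ominus>\<^bsub>M\<^esub> y) = a \<odot>\<^bsub>M\<^esub> x \<ominus>\<^bsub>M\<^esub> a \<odot>\<^bsub>M\<^esub> y"
proof -
  have "a \<odot>\<^bsub>M\<^esub> (\<ominus>\<^bsub>M\<^esub> y) \<oplus>\<^bsub>M\<^esub> a \<odot>\<^bsub>M\<^esub> y = \<zero>\<^bsub>M\<^esub>"
    using assms smult_r_distr[of a "\<ominus>\<^bsub>M\<^esub> y" y] by (simp add: M.l_neg smult_zero)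
  then have "a \<odot>\<^bsub>M\<^esub> (\<ominus>\<^bsub>M\<^esub> y) = \<ominus>\<^bsub>M\<^esub> (a \<odot>\<^bsub>M\<^esub> y)"
    using assms smult_closed M.minus_equality by (metis M.add.inv_closed)
  then show ?thesis
    using assms by (simp add: a_minus_def smult_r_distr)
qed

lemma (in left_module) minus_add_cancel:
  assumes "a \<in> carrier M" "b \<in> carrier M"
  shows "(a \<ominus>\<^bsub>M\<^esub> b) \<oplus>\<^bsub>M\<^esub> b = a"
  using assms by (simp add: a_minus_def M.a_ac M.r_neg)

lemma (in left_module) minus_eq_zero_iff:
  assumes "x \<in> carrier M" "y \<in> carrier M"
  shows "x \<ominus>\<^bsub>M\<^esub> y = \<zero>\<^bsub>M\<^esub> \<longleftrightarrow> x = y"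
proof
  assume "x \<ominus>\<^bsub>M\<^esub> y = \<zero>\<^bsub>M\<^esub>"
  with minus_add_cancel[OF assms] assms show "x = y" by simp
qed (use assms in \<open>simp add: a_minus_def M.r_neg\<close>)

lemma (in left_module) add_minus_add:
  assumes "a \<in> carrier M" "b \<in> carrier M" "c \<in> carrier M" "d \<in> carrier M"
  shows "(a \<oplus>\<^bsub>M\<^esub> b) \<ominus>\<^bsub>M\<^esub> (c \<oplus>\<^bsub>M\<^esub> d) = (a \<ominus>\<^bsub>M\<^esub> c) \<oplus>\<^bsub>M\<^esub> (b \<ominus>\<^bsub>M\<^esub> d)"
  using assms by (simp add: a_minus_def M.minus_add M.a_ac)

section \<open>Homomorphisms\<close>

lemma mod_homI:
  assumes "\<And>x. x \<in> carrier M \<Longrightarrow> f x \<in> carrier N"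
    and "\<And>x y. \<lbrakk>x \<in> carrier M; y \<in> carrier M\<rbrakk> \<Longrightarrow> f (x \<oplus>\<^bsub>M\<^esub> y) = f x \<oplus>\<^bsub>N\<^esub> f y"
    and "\<And>a x. \<lbrakk>a \<in> carrier R; x \<in> carrier M\<rbrakk> \<Longrightarrow> f (a \<odot>\<^bsub>M\<^esub> x) = a \<odot>\<^bsub>N\<^esub> f x"
  shows "f \<in> mod_hom R M N"
  using assms by (auto simp: mod_hom_def hom_def)

lemma
  assumes "f \<in> mod_hom R M N"
  shows mod_hom_closed: "x \<in> carrier M \<Longrightarrow> f x \<in> carrier N"
    and mod_hom_add: "\<lbrakk>x \<in> carrier M; y \<in> carrier M\<rbrakk> \<Longrightarrow> f (x \<oplus>\<^bsub>M\<^esub> y) = f x \<oplus>\<^bsub>N\<^esub> f y"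
    and mod_hom_smult: "\<lbrakk>a \<in> carrier R; x \<in> carrier M\<rbrakk> \<Longrightarrow> f (a \<odot>\<^bsub>M\<^esub> x) = a \<odot>\<^bsub>N\<^esub> f x"
  using assms by (auto simp: mod_hom_def hom_def)

lemma mod_hom_comp:
  assumes "f \<in> mod_hom R M N" "g \<in> mod_hom R N P"
  shows "g \<circ> f \<in> mod_hom R M P"
  using assms by (intro mod_homI) (auto simp: mod_hom_closed mod_hom_add mod_hom_smult)

lemma mod_hom_zero:
  assumes "left_module R M" "left_module R N" "f \<in> mod_hom R M N"
  shows "f \<zero>\<^bsub>M\<^esub> = \<zero>\<^bsub>N\<^esub>"
proof -
  interpret M: left_module R M by fact
  interpret N: left_module R N by fact
  have "f \<zero>\<^bsub>M\<^esub> \<oplus>\<^bsub>N\<^esub> f \<zero>\<^bsub>M\<^esub> = f \<zero>\<^bsub>M\<^esub>"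
    using mod_hom_add[OF assms(3), of "\<zero>\<^bsub>M\<^esub>" "\<zero>\<^bsub>M\<^esub>"] by simp
  then show ?thesis
    using mod_hom_closed[OF assms(3)] N.add.l_cancel_one M.zero_closed by metis
qed

lemma mod_hom_minus:
  assumes "left_module R M" "left_module R N" "f \<in> mod_hom R M N" "x \<in> carrier M" "y \<in> carrier M"
  shows "f (x \<ominus>\<^bsub>M\<^esub> y) = f x \<ominus>\<^bsub>N\<^esub> f y"
proof -
  interpret M: left_module R M by fact
  interpret N: left_module R N by fact
  note closed = mod_hom_closed[OF assms(3)]
  have "f (x \<ominus>\<^bsub>M\<^esub> y) \<oplus>\<^bsub>N\<^esub> f y = f x"
    using mod_hom_add[OF assms(3), of "x \<ominus>\<^bsub>M\<^esub> y" y] assms M.minus_add_cancel by simp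
  also have "\<dots> = (f x \<ominus>\<^bsub>N\<^esub> f y) \<oplus>\<^bsub>N\<^esub> f y"
    using assms(4,5) closed by (simp add: N.minus_add_cancel)
  finally show ?thesis
    using assms(4,5) closed by simp
qed

lemma mod_hom_eq_iff:
  assumes "left_module R M" "left_module R N" "f \<in> mod_hom R M N" "x \<in> carrier M" "y \<in> carrier M"
  shows "f x = f y \<longleftrightarrow> f (x \<ominus>\<^bsub>M\<^esub> y) = \<zero>\<^bsub>N\<^esub>"
  unfolding mod_hom_minus[OF assms]
  using left_module.minus_eq_zero_iff[OF assms(2)] mod_hom_closed[OF assms(3)] assms(4,5) by simp

lemma mod_hom_inj_on_iff:
  assumes "left_module R M" "left_module R N" "f \<in> mod_hom R M N"
  shows "inj_on f (carrier M) \<longleftrightarrow> (\<forall>x\<in>carrier M. f x = \<zero>\<^bsub>N\<^esub> \<longrightarrow> x = \<zero>\<^bsub>M\<^esub>)"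
proof -
  interpret M: left_module R M by fact
  show ?thesis
  proof
    assume "inj_on f (carrier M)"
    then show "\<forall>x\<in>carrier M. f x = \<zero>\<^bsub>N\<^esub> \<longrightarrow> x = \<zero>\<^bsub>M\<^esub>"
      using mod_hom_zero[OF assms] by (metis M.zero_closed inj_onD)
  next
    assume "\<forall>x\<in>carrier M. f x = \<zero>\<^bsub>N\<^esub> \<longrightarrow> x = \<zero>\<^bsub>M\<^esub>"
    then show "inj_on f (carrier M)"
      by (intro inj_onI)
        (metis mod_hom_eq_iff[OF assms] M.minus_eq_zero_iff M.M.minus_closed)
  qed
qed

section \<open>Submodules\<close>

lemma (in left_module) submoduleI:
  assumes "H \<subseteq> carrier M" "\<zero>\<^bsub>M\<^esub> \<in> H"
    and "\<And>x y. \<lbrakk>x \<in> H; y \<in> H\<rbrakk> \<Longrightarrow> x \<oplus>\<^bsub>M\<^esub> y \<in> H"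
    and "\<And>a x. \<lbrakk>a \<in> carrier R; x \<in> H\<rbrakk> \<Longrightarrow> a \<odot>\<^bsub>M\<^esub> x \<in> H"
  shows "submodule H R M"
proof (intro submodule.intro submodule_axioms.intro subgroup.intro)
  \<comment> \<open>Closure under negatives comes from the action of the scalar
    \<open>\<ominus> \<one>\<close>.\<close>
  fix x assume "x \<in> H"
  then have "\<ominus>\<^bsub>M\<^esub> x \<in> H"
    using assms smult_minus_one by (metis R.add.inv_closed R.one_closed subsetD)
  then show "inv\<^bsub>add_monoid M\<^esub> x \<in> H"
    by (simp add: a_inv_def)
qed (use assms in auto)

lemma (in left_module)
  assumes "submodule H R M"
  shows submodule_subset: "H \<subseteq> carrier M"
    and submodule_zero: "\<zero>\<^bsub>M\<^esub> \<in> H"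
    and submodule_add: "\<lbrakk>x \<in> H; y \<in> H\<rbrakk> \<Longrightarrow> x \<oplus>\<^bsub>M\<^esub> y \<in> H"
    and submodule_smult: "\<lbrakk>a \<in> carrier R; x \<in> H\<rbrakk> \<Longrightarrow> a \<odot>\<^bsub>M\<^esub> x \<in> H"
    and submodule_minus: "\<lbrakk>x \<in> H; y \<in> H\<rbrakk> \<Longrightarrow> x \<ominus>\<^bsub>M\<^esub> y \<in> H"
proof -
  interpret H: submodule H R M by fact
  show "H \<subseteq> carrier M" "\<zero>\<^bsub>M\<^esub> \<in> H"
    "\<lbrakk>x \<in> H; y \<in> H\<rbrakk> \<Longrightarrow> x \<oplus>\<^bsub>M\<^esub> y \<in> H"
    "\<lbrakk>a \<in> carrier R; x \<in> H\<rbrakk> \<Longrightarrow> a \<odot>\<^bsub>M\<^esub> x \<in> H"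
    "\<lbrakk>x \<in> H; y \<in> H\<rbrakk> \<Longrightarrow> x \<ominus>\<^bsub>M\<^esub> y \<in> H"
    using H.subset H.one_closed H.m_closed[of x y] H.m_closed[of x "\<ominus>\<^bsub>M\<^esub> y"] H.m_inv_closed[of y]
    by (auto simp: a_inv_def a_minus_def)
qed

lemma (in left_module) submodule_left_module:
  assumes "submodule H R M"
  shows "left_module R (M\<lparr>carrier := H\<rparr>)"
proof -
  note H = submodule_subset[OF assms] submodule_zero[OF assms] submodule_add[OF assms]
    submodule_smult[OF assms]
  have "\<exists>y\<in>H. y \<oplus>\<^bsub>M\<^esub> x = \<zero>\<^bsub>M\<^esub>" if "x \<in> H" for x
    using H(1) submodule_minus[OF assms H(2) that] that
    by (intro bexI[of _ "\<zero>\<^bsub>M\<^esub> \<ominus>\<^bsub>M\<^esub> x"]) (auto simp: subset_iff minus_add_cancel)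
  then show ?thesis
    using H R.ring_axioms
    by (intro left_moduleI)
      (auto simp: subset_iff M.a_assoc smult_l_distr smult_r_distr smult_assoc smult_one intro: M.a_comm)
qed

lemma mod_hom_restrict:
  assumes "f \<in> mod_hom R M N" "H \<subseteq> carrier M" "\<And>x. x \<in> H \<Longrightarrow> f x \<in> K"
  shows "f \<in> mod_hom R (M\<lparr>carrier := H\<rparr>) (N\<lparr>carrier := K\<rparr>)"
  using assms by (intro mod_homI) (auto simp: mod_hom_add mod_hom_smult subset_iff)

lemma mod_hom_restrict_dom:
  assumes "f \<in> mod_hom R M N" "H \<subseteq> carrier M"
  shows "f \<in> mod_hom R (M\<lparr>carrier := H\<rparr>) N"
  using assms by (intro mod_homI) (auto simp: mod_hom_add mod_hom_smult mod_hom_closed subset_iff)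

lemma mod_hom_extend_codomain:
  assumes "f \<in> mod_hom R M (N\<lparr>carrier := K\<rparr>)" "K \<subseteq> carrier N"
  shows "f \<in> mod_hom R M N"
  using assms by (auto simp: mod_hom_def hom_def)

lemma mod_hom_incl:
  assumes "H \<subseteq> K"
  shows "(\<lambda>x. x) \<in> mod_hom R (M\<lparr>carrier := H\<rparr>) (M\<lparr>carrier := K\<rparr>)"
  using assms by (intro mod_homI) auto

lemma submodule_vimage:
  assumes "left_module R M" "left_module R N" "f \<in> mod_hom R M N" "submodule H R N"
  shows "submodule {x \<in> carrier M. f x \<in> H} R M"
proof -
  interpret M: left_module R M by fact
  interpret N: left_module R N by fact
  show ?thesis
    using mod_hom_zero[OF assms(1-3)] N.submodule_zero[OF assms(4)] N.submodule_add[OF assms(4)]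
      N.submodule_smult[OF assms(4)]
    by (intro M.submoduleI)
      (auto simp: mod_hom_add[OF assms(3)] mod_hom_smult[OF assms(3)] M.smult_closed)
qed

lemma (in left_module) submodule_zero_set: "submodule {\<zero>\<^bsub>M\<^esub>} R M"
  by (intro submoduleI) (auto simp: smult_zero)

lemma submodule_kernel:
  assumes "left_module R M" "left_module R N" "f \<in> mod_hom R M N"
  shows "submodule {x \<in> carrier M. f x = \<zero>\<^bsub>N\<^esub>} R M"
  using submodule_vimage[OF assms left_module.submodule_zero_set[OF assms(2)]] by simp

lemma (in left_module) submodule_Union_chain:
  assumes "Z \<noteq> {}" "\<And>H. H \<in> Z \<Longrightarrow> submodule H R M"
    and "\<And>H K. \<lbrakk>H \<in> Z; K \<in> Z\<rbrakk> \<Longrightarrow> H \<subseteq> K \<or> K \<subseteq> H"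
  shows "submodule (\<Union>Z) R M"
proof (rule submoduleI)
  show "\<Union>Z \<subseteq> carrier M" "\<zero>\<^bsub>M\<^esub> \<in> \<Union>Z"
    using assms submodule_subset submodule_zero by blast+
  show "x \<oplus>\<^bsub>M\<^esub> y \<in> \<Union>Z" if xy: "x \<in> \<Union>Z" "y \<in> \<Union>Z" for x y
  proof -
    obtain H K where HK: "H \<in> Z" "K \<in> Z" "x \<in> H" "y \<in> K"
      using xy by blast
    with assms(3)[OF HK(1,2)] obtain L where "L \<in> Z" "x \<in> L" "y \<in> L"
      by blast
    with submodule_add[OF assms(2)] show ?thesis
      by blast
  qed
  show "a \<odot>\<^bsub>M\<^esub> x \<in> \<Union>Z" if "a \<in> carrier R" "x \<in> \<Union>Z" for a x
    using that submodule_smult[OF assms(2)] by blast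
qed

lemma (in left_module) submodule_trans:
  assumes "submodule H R M" "submodule K R (M\<lparr>carrier := H\<rparr>)"
  shows "submodule K R M"
proof -
  interpret H: left_module R "M\<lparr>carrier := H\<rparr>"
    by (rule submodule_left_module) fact
  show ?thesis
    using H.submodule_subset[OF assms(2)] H.submodule_zero[OF assms(2)] submodule_subset[OF assms(1)]
      H.submodule_add[OF assms(2)] H.submodule_smult[OF assms(2)]
    by (intro submoduleI) auto
qed

lemma (in left_module) submodule_restrict:
  assumes "submodule H R M" "submodule K R M" "K \<subseteq> H"
  shows "submodule K R (M\<lparr>carrier := H\<rparr>)"
proof -
  interpret H: left_module R "M\<lparr>carrier := H\<rparr>"
    by (rule submodule_left_module) fact
  show ?thesis
    using assms(3) submodule_zero[OF assms(2)] submodule_add[OF assms(2)] submodule_smult[OF assms(2)]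
    by (intro H.submoduleI) auto
qed

text \<open>The fibres of \<open>p\<close> form a congruence, so operations computed on chosen
  preimages descend to the image. With \<open>p\<close> injective this copies a module onto another
  type; with \<open>p\<close> selecting coset representatives it yields quotients.\<close>

lemma image_left_module:
  fixes R :: "'r ring" and M :: "('r, 'a) module" and p :: "'a \<Rightarrow> 'b"
  assumes "left_module R M"
    and add: "\<And>x x' y y'. \<lbrakk>x \<in> carrier M; x' \<in> carrier M; y \<in> carrier M; y' \<in> carrier M;
      p x = p x'; p y = p y'\<rbrakk> \<Longrightarrow> p (x \<oplus>\<^bsub>M\<^esub> y) = p (x' \<oplus>\<^bsub>M\<^esub> y')"
    and smult: "\<And>a x x'. \<lbrakk>a \<in> carrier R; x \<in> carrier M; x' \<in> carrier M; p x = p x'\<rbrakk> \<Longrightarrow>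
      p (a \<odot>\<^bsub>M\<^esub> x) = p (a \<odot>\<^bsub>M\<^esub> x')"
  obtains Q :: "('r, 'b) module"
  where "left_module R Q" "carrier Q = p ` carrier M" "p \<in> mod_hom R M Q"
proof -
  interpret M: left_module R M by fact
  define s where "s = inv_into (carrier M) p"
  define Q :: "('r, 'b) module" where "Q = \<lparr>carrier = p ` carrier M, monoid.mult = undefined, monoid.one = undefined,
     ring.zero = p \<zero>\<^bsub>M\<^esub>, ring.add = (\<lambda>x y. p (s x \<oplus>\<^bsub>M\<^esub> s y)),
     module.smult = (\<lambda>r x. p (r \<odot>\<^bsub>M\<^esub> s x))\<rparr>"
  have s: "s (p x) \<in> carrier M" "p (s (p x)) = p x" if "x \<in> carrier M" for x
    using that by (auto simp: s_def inv_into_into f_inv_into_f)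
  have p_add: "p x \<oplus>\<^bsub>Q\<^esub> p y = p (x \<oplus>\<^bsub>M\<^esub> y)" if "x \<in> carrier M" "y \<in> carrier M" for x y
    using that s by (auto simp: Q_def intro!: add)
  have p_smult: "a \<odot>\<^bsub>Q\<^esub> p x = p (a \<odot>\<^bsub>M\<^esub> x)" if "a \<in> carrier R" "x \<in> carrier M" for a x
    using that s by (auto simp: Q_def intro!: smult)
  have Q: "carrier Q = p ` carrier M" "\<zero>\<^bsub>Q\<^esub> = p \<zero>\<^bsub>M\<^esub>"
    by (auto simp: Q_def)
  show ?thesis
  proof
    show "left_module R Q"
    proof (rule left_moduleI)
      fix x assume "x \<in> carrier Q"
      then obtain y where "x = p y" "y \<in> carrier M"
        by (auto simp: Q)
      then show "\<exists>y\<in>carrier Q. y \<oplus>\<^bsub>Q\<^esub> x = \<zero>\<^bsub>Q\<^esub>"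
        by (intro bexI[of _ "p (\<ominus>\<^bsub>M\<^esub> y)"]) (auto simp: Q p_add M.M.l_neg)
    next
      fix x y assume "x \<in> carrier Q" "y \<in> carrier Q"
      then show "x \<oplus>\<^bsub>Q\<^esub> y = y \<oplus>\<^bsub>Q\<^esub> x"
        by (auto simp: Q p_add M.M.a_comm)
    qed (auto simp: Q p_add p_smult M.smult_closed M.M.a_assoc M.smult_l_distr M.smult_r_distr
        M.smult_assoc M.smult_one M.R.ring_axioms)
    show "p \<in> mod_hom R M Q"
      by (rule mod_homI) (auto simp: Q p_add p_smult)
  qed (rule Q)
qed

text \<open>The elements of \<open>Q\<close> are coset representatives instead of cosets.
  \<open>Q\<close> thus has the same element type as \<open>M\<close>, and quotients of modules on
  \<open>'u\<close> stay on \<open>'u\<close>.\<close>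

lemma quotient_module:
  fixes R :: "'r ring" and M :: "('r, 'a) module"
  assumes "left_module R M" "submodule H R M"
  obtains Q :: "('r, 'a) module" and p
  where "left_module R Q" "p \<in> mod_hom R M Q" "carrier Q = p ` carrier M"
    "\<And>x. x \<in> carrier M \<Longrightarrow> p x = \<zero>\<^bsub>Q\<^esub> \<longleftrightarrow> x \<in> H"
proof -
  interpret M: left_module R M by fact
  define p where "p x = (SOME y. y \<in> carrier M \<and> x \<ominus>\<^bsub>M\<^esub> y \<in> H)" for x
  have trans: "x \<ominus>\<^bsub>M\<^esub> z \<in> H"
    if "x \<in> carrier M" "y \<in> carrier M" "z \<in> carrier M" "x \<ominus>\<^bsub>M\<^esub> y \<in> H" "y \<ominus>\<^bsub>M\<^esub> z \<in> H" for x y z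
  proof -
    have "(x \<ominus>\<^bsub>M\<^esub> y) \<oplus>\<^bsub>M\<^esub> (y \<ominus>\<^bsub>M\<^esub> z) = ((x \<ominus>\<^bsub>M\<^esub> y) \<oplus>\<^bsub>M\<^esub> y) \<ominus>\<^bsub>M\<^esub> z"
      using that by (simp add: a_minus_def M.M.a_assoc)
    then show ?thesis
      using M.submodule_add[OF assms(2) that(4,5)] that by (simp add: M.minus_add_cancel)
  qed
  have sym: "y \<ominus>\<^bsub>M\<^esub> x \<in> H" if "x \<in> carrier M" "y \<in> carrier M" "x \<ominus>\<^bsub>M\<^esub> y \<in> H" for x y
  proof -
    have "y \<ominus>\<^bsub>M\<^esub> x = \<zero>\<^bsub>M\<^esub> \<ominus>\<^bsub>M\<^esub> (x \<ominus>\<^bsub>M\<^esub> y)"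
      using that by (simp add: a_minus_def M.M.minus_add M.M.a_comm)
    then show ?thesis
      using M.submodule_minus[OF assms(2) M.submodule_zero[OF assms(2)] that(3)] by simp
  qed
  have p: "p x \<in> carrier M \<and> x \<ominus>\<^bsub>M\<^esub> p x \<in> H" if "x \<in> carrier M" for x
    unfolding p_def
    by (rule someI[of _ x]) (use that M.submodule_zero[OF assms(2)] M.minus_eq_zero_iff in metis)
  have p_eq: "p x = p y \<longleftrightarrow> x \<ominus>\<^bsub>M\<^esub> y \<in> H" if "x \<in> carrier M" "y \<in> carrier M" for x y
  proof
    assume "p x = p y"
    then show "x \<ominus>\<^bsub>M\<^esub> y \<in> H"
      using p that sym trans by metis
  next
    assume "x \<ominus>\<^bsub>M\<^esub> y \<in> H"
    \<comment> \<open>Congruent elements put the same predicate under \<open>SOME\<close>, so they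
      receive the same representative.\<close>
    then have "z \<in> carrier M \<and> x \<ominus>\<^bsub>M\<^esub> z \<in> H \<longleftrightarrow> z \<in> carrier M \<and> y \<ominus>\<^bsub>M\<^esub> z \<in> H" for z
      using that sym trans by metis
    then show "p x = p y"
      by (simp add: p_def)
  qed
  obtain Q where Q: "left_module R Q" "carrier Q = p ` carrier M" "p \<in> mod_hom R M Q"
  proof (rule image_left_module[OF assms(1), of p])
    show "p (x \<oplus>\<^bsub>M\<^esub> y) = p (x' \<oplus>\<^bsub>M\<^esub> y')" if "x \<in> carrier M" "x' \<in> carrier M" "y \<in> carrier M"
      "y' \<in> carrier M" "p x = p x'" "p y = p y'" for x x' y y'
      using that M.submodule_add[OF assms(2)] by (auto simp: p_eq M.add_minus_add)
    show "p (a \<odot>\<^bsub>M\<^esub> x) = p (a \<odot>\<^bsub>M\<^esub> x')"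
      if "a \<in> carrier R" "x \<in> carrier M" "x' \<in> carrier M" "p x = p x'" for a x x'
      using that M.submodule_smult[OF assms(2)]
      by (auto simp: p_eq M.smult_closed M.smult_minus[symmetric])
  qed
  show ?thesis
  proof (rule that[OF Q(1,3,2)])
    show "p x = \<zero>\<^bsub>Q\<^esub> \<longleftrightarrow> x \<in> H" if "x \<in> carrier M" for x
      using p_eq[OF that M.M.zero_closed] mod_hom_zero[OF assms(1) Q(1,3)] that
      by (simp add: a_minus_def M.M.add.inv_one[folded a_inv_def])
  qed
qed

text \<open>Two preimages under \<open>p\<close> differ by an element of its kernel, on which
  \<open>h\<close> vanishes, so \<open>k\<close> may be computed on any chosen preimage.\<close>

lemma mod_hom_factor:
  assumes "left_module R M" "left_module R Q" "left_module R X"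
    and p: "p \<in> mod_hom R M Q" "carrier Q = p ` carrier M" and h: "h \<in> mod_hom R M X"
    and ker: "\<And>x. \<lbrakk>x \<in> carrier M; p x = \<zero>\<^bsub>Q\<^esub>\<rbrakk> \<Longrightarrow> h x = \<zero>\<^bsub>X\<^esub>"
  obtains k where "k \<in> mod_hom R Q X" "\<And>x. x \<in> carrier M \<Longrightarrow> k (p x) = h x"
proof -
  interpret M: left_module R M by fact
  define k where "k y = h (inv_into (carrier M) p y)" for y
  have k: "k (p x) = h x" if "x \<in> carrier M" for x
  proof -
    define x' where "x' = inv_into (carrier M) p (p x)"
    have x': "x' \<in> carrier M" "p x' = p x"
      using that by (auto simp: x'_def inv_into_into f_inv_into_f)
    then have "p (x' \<ominus>\<^bsub>M\<^esub> x) = \<zero>\<^bsub>Q\<^esub>"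
      using mod_hom_eq_iff[OF assms(1,2) p(1)] that by metis
    then have "h x' = h x"
      using ker mod_hom_eq_iff[OF assms(1,3) h] that x'(1) M.M.minus_closed by metis
    then show ?thesis by (simp add: k_def x'_def)
  qed
  have "k \<in> mod_hom R Q X"
    by (rule mod_homI)
      (auto simp: p(2) k mod_hom_closed[OF h] mod_hom_add[OF h] mod_hom_smult[OF h]
        mod_hom_add[OF p(1), symmetric] mod_hom_smult[OF p(1), symmetric] M.smult_closed)
  with k that show ?thesis by blast
qed

lemma mod_hom_inverse:
  assumes "left_module R M" "f \<in> mod_hom R M N" "bij_betw f (carrier M) (carrier N)"
  shows "inv_into (carrier M) f \<in> mod_hom R N M"
proof -
  interpret M: left_module R M by fact
  have f: "inj_on f (carrier M)" "carrier N = f ` carrier M"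
    using assms(3) by (auto simp: bij_betw_def)
  show ?thesis
    by (rule mod_homI)
      (auto simp: f mod_hom_add[OF assms(2), symmetric]
        mod_hom_smult[OF assms(2), symmetric] M.smult_closed)
qed

section \<open>Small sizes\<close>

lemma infinite_Times_lepoll:
  assumes "infinite C" shows "C \<times> C \<lesssim> C"
  using card_of_Times_same_infinite[OF assms]
  by (metis card_of_ordIso eqpoll_def eqpoll_imp_lepoll)

lemma infinite_lists_lepoll:
  assumes "infinite C" shows "lists C \<lesssim> C"
proof -
  obtain p where p: "inj_on p (C \<times> C)" "p ` (C \<times> C) \<subseteq> C"
    using infinite_Times_lepoll[OF assms] by (auto simp: lepoll_def)
  obtain c :: "nat \<Rightarrow> 'a" where c: "inj c" "range c \<subseteq> C"
    using assms infinite_countable_subset by blast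
  \<comment> \<open>\<open>e\<close> folds the pairing \<open>p\<close> over a list, with
    \<open>c 0\<close> as end marker. Since \<open>p\<close> may take the value \<open>c 0\<close>
    as well, injectivity of \<open>e\<close> is claimed only among lists of equal length; the final
    code pairs it with the length, embedded in \<open>C\<close> by \<open>c\<close>.\<close>
  define e where "e xs = foldr (\<lambda>x y. p (x, y)) xs (c 0)" for xs
  have e_closed: "e xs \<in> C" if "xs \<in> lists C" for xs
    using that
  proof (induction xs)
    case Nil
    then show ?case using c by (auto simp: e_def)
  next
    case (Cons x xs)
    then have "p (x, e xs) \<in> C"
      using p(2) by (intro subsetD[OF p(2)] imageI) auto
    then show ?case by (simp add: e_def)
  qed
  have e_inj: "xs = ys"
    if "length xs = length ys" "xs \<in> lists C" "ys \<in> lists C" "e xs = e ys" for xs ys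
    using that
  proof (induction rule: list_induct2)
    case (Cons x xs y ys)
    then have "p (x, e xs) = p (y, e ys)"
      by (simp add: e_def)
    then have "(x, e xs) = (y, e ys)"
      using Cons.prems e_closed by (intro inj_onD[OF p(1)]) auto
    with Cons show ?case by auto
  qed simp
  have "inj_on (\<lambda>xs. p (c (length xs), e xs)) (lists C)"
  proof (rule inj_onI)
    fix xs ys assume *: "xs \<in> lists C" "ys \<in> lists C"
      "p (c (length xs), e xs) = p (c (length ys), e ys)"
    then have "(c (length xs), e xs) = (c (length ys), e ys)"
      using c e_closed by (intro inj_onD[OF p(1)]) auto
    with * c e_inj show "xs = ys"
      by (auto dest: injD)
  qed
  moreover have "(\<lambda>xs. p (c (length xs), e xs)) ` lists C \<subseteq> C"
  proof (rule image_subsetI)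
    fix xs assume "xs \<in> lists C"
    then have "(c (length xs), e xs) \<in> C \<times> C"
      using c e_closed by auto
    then show "p (c (length xs), e xs) \<in> C"
      using p(2) by blast
  qed
  ultimately show ?thesis
    by (auto simp: lepoll_def)
qed

context smallness
begin

lemma of_small_sizeE:
  assumes "of_small_size small A"
  obtains B h where "small B" "bij_betw h B A"
proof -
  obtain B where "small B" "A \<approx> B"
    using assms by (auto simp: of_small_size_def)
  then show ?thesis
    using that eqpoll_sym[of A B] by (auto simp: eqpoll_def)
qed

lemma of_small_size_lepoll:
  assumes "of_small_size small A" "B \<lesssim> A"
  shows "of_small_size small B"
proof -
  obtain C where C: "small C" "A \<approx> C"
    using assms(1) by (auto simp: of_small_size_def)
  then have "B \<lesssim> C"
    using assms(2) by (metis eqpoll_imp_lepoll lepoll_trans)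
  then obtain h where "inj_on h B" "h ` B \<subseteq> C"
    by (auto simp: lepoll_def)
  then show ?thesis
    using small_subset[OF C(1)] by (auto simp: of_small_size_def eqpoll_def bij_betw_def)
qed

lemma of_small_size_image: "of_small_size small A \<Longrightarrow> of_small_size small (h ` A)"
  using of_small_size_lepoll image_lepoll by blast

lemma of_small_size_subset: "of_small_size small A \<Longrightarrow> B \<subseteq> A \<Longrightarrow> of_small_size small B"
  using of_small_size_lepoll subset_imp_lepoll by blast

text \<open>Replacement is stated for maps from \<open>'u\<close> to \<open>'u\<close>, and a
  bijection between two subsets of \<open>'u\<close> is such a map. Smallness therefore depends on
  cardinality only.\<close>

lemma of_small_size_iff_small: "of_small_size small A \<longleftrightarrow> small A"
proof
  assume "of_small_size small A"
  then obtain B h where "small B" "bij_betw h B A"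
    by (rule of_small_sizeE)
  then show "small A"
    using small_image by (auto simp: bij_betw_def)
qed (auto simp: of_small_size_def)

text \<open>Carries the union axiom from index sets in \<open>'u\<close> over to index sets of any
  type.\<close>

lemma small_UN:
  assumes "of_small_size small J" "\<And>j. j \<in> J \<Longrightarrow> small (A j)"
  shows "small (\<Union>j\<in>J. A j)"
proof -
  obtain K h where K: "small K" "bij_betw h K J"
    using assms(1) by (rule of_small_sizeE)
  then have "(\<Union>j\<in>J. A j) = (\<Union>k\<in>K. A (h k))"
    by (auto simp: bij_betw_def)
  then show ?thesis
    using K assms(2) small_Union[OF K(1), of "\<lambda>k. A (h k)"] by (auto simp: bij_betw_def)
qed

text \<open>A binary union is a union indexed by \<open>bool\<close>, and \<open>bool\<close> is of
  small size because it embeds into an infinite small set.\<close>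

lemma small_Un:
  assumes "small A" "small B" shows "small (A \<union> B)"
proof -
  obtain C where C: "small C" "infinite C"
    using small_infinite by blast
  have "of_small_size small (UNIV :: bool set)"
  proof (rule of_small_size_lepoll)
    show "of_small_size small C"
      using C by (simp add: of_small_size_iff_small)
    show "(UNIV :: bool set) \<lesssim> C"
      using C(2) by (rule finite_lepoll_infinite) simp
  qed
  from small_UN[OF this, of "\<lambda>b. if b then A else B"] assms show ?thesis
    by (simp add: UNIV_bool Un_commute)
qed

text \<open>A common infinite bound reduces products and lists to the arithmetic of a single
  infinite cardinal, which absorbs both.\<close>

lemma of_small_size_lepoll_infinite:
  assumes "of_small_size small A" "of_small_size small B"
  obtains C where "small C" "infinite C" "A \<lesssim> C" "B \<lesssim> C"
proof -
  obtain A' B' C where AB: "small A'" "A \<approx> A'" "small B'" "B \<approx> B'" and C: "small C" "infinite C"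
    using assms small_infinite unfolding of_small_size_def by blast
  show ?thesis
  proof
    show "small (A' \<union> B' \<union> C)" "infinite (A' \<union> B' \<union> C)"
      using AB C by (simp_all add: small_Un)
    show "A \<lesssim> A' \<union> B' \<union> C"
      by (rule lepoll_trans[OF eqpoll_imp_lepoll[OF AB(2)]]) (auto intro: subset_imp_lepoll)
    show "B \<lesssim> A' \<union> B' \<union> C"
      by (rule lepoll_trans[OF eqpoll_imp_lepoll[OF AB(4)]]) (auto intro: subset_imp_lepoll)
  qed
qed

lemma of_small_size_Times:
  assumes "of_small_size small A" "of_small_size small B"
  shows "of_small_size small (A \<times> B)"
proof -
  obtain C where C: "small C" "infinite C" "A \<lesssim> C" "B \<lesssim> C"
    using of_small_size_lepoll_infinite[OF assms] .
  then have "A \<times> B \<lesssim> C"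
    using infinite_Times_lepoll times_lepoll_mono lepoll_trans by blast
  with C(1) show ?thesis
    using of_small_size_lepoll of_small_size_iff_small by blast
qed

lemma of_small_size_lists:
  assumes "of_small_size small A"
  shows "of_small_size small (lists A)"
proof -
  obtain C where C: "small C" "infinite C" "A \<lesssim> C"
    using of_small_size_lepoll_infinite[OF assms assms] .
  then have "lists A \<lesssim> C"
    using infinite_lists_lepoll lists_lepoll_mono lepoll_trans by blast
  with C(1) show ?thesis
    using of_small_size_lepoll of_small_size_iff_small by blast
qed

lemma of_small_size_Fpow:
  assumes "of_small_size small A"
  shows "of_small_size small (Fpow A)"
proof -
  have "Fpow A = set ` lists A"
    by (auto simp: Fpow_def lists_eq_set dest: finite_list)
  then show ?thesis
    using of_small_size_image[OF of_small_size_lists[OF assms]] by simp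
qed

lemma ex_iso_RMod:
  fixes R :: "'r ring" and M :: "('r, 'a) module"
  assumes "left_module R M" "of_small_size small (carrier M)"
  obtains N \<phi> where "N \<in> RMod small R" "\<phi> \<in> mod_hom R M N" "bij_betw \<phi> (carrier M) (carrier N)"
proof -
  interpret M: left_module R M by fact
  obtain B \<phi> where B: "small B" "bij_betw \<phi> (carrier M) B"
    using assms(2) by (auto simp: of_small_size_def eqpoll_def)
  then have inj: "inj_on \<phi> (carrier M)"
    by (auto simp: bij_betw_def)
  obtain N where "left_module R N" "carrier N = \<phi> ` carrier M" "\<phi> \<in> mod_hom R M N"
    by (rule image_left_module[OF assms(1), of \<phi>]) (auto dest: inj_onD[OF inj])
  with B that show ?thesis
    by (auto simp: RMod_def bij_betw_def)
qed

end

section \<open>Short exact sequences and their splittings\<close>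

lemma short_exact_iff:
  "short_exact R A f B g C \<longleftrightarrow> f \<in> mod_hom R A B \<and> g \<in> mod_hom R B C \<and> inj_on f (carrier A) \<and>
    g ` carrier B = carrier C \<and> (\<forall>x\<in>carrier B. g x = \<zero>\<^bsub>C\<^esub> \<longleftrightarrow> x \<in> f ` carrier A)"
  unfolding short_exact_def a_kernel_def kernel_def
  by (auto simp: mod_hom_closed set_eq_iff image_iff)

lemma short_exact_iso_right:
  assumes "left_module R C" "left_module R C'" "short_exact R A f B g C"
    and "\<phi> \<in> mod_hom R C C'" "bij_betw \<phi> (carrier C) (carrier C')"
  shows "short_exact R A f B (\<phi> \<circ> g) C'"
proof -
  have \<phi>: "\<phi> c = \<zero>\<^bsub>C'\<^esub> \<longleftrightarrow> c = \<zero>\<^bsub>C\<^esub>" if "c \<in> carrier C" for c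
    using that assms(5) mod_hom_inj_on_iff[OF assms(1,2,4)] mod_hom_zero[OF assms(1,2,4)]
    by (auto simp: bij_betw_def)
  have "(\<phi> \<circ> g) ` carrier B = carrier C'"
    using assms(3,5) by (simp only: image_comp[symmetric] bij_betw_def short_exact_iff)
  moreover have "g x \<in> carrier C" if "x \<in> carrier B" for x
    using that assms(3) by (auto simp: short_exact_iff)
  ultimately show ?thesis
    using assms(3) mod_hom_comp[of g R B C, OF _ assms(4)] by (auto simp: short_exact_iff \<phi>)
qed

lemma short_exact_iso_left:
  assumes "short_exact R A f B g C" "\<phi> \<in> mod_hom R A' A" "bij_betw \<phi> (carrier A') (carrier A)"
  shows "short_exact R A' (f \<circ> \<phi>) B g C"
proof -
  have "(f \<circ> \<phi>) ` carrier A' = f ` carrier A"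
    using assms(3) by (simp only: image_comp[symmetric] bij_betw_def)
  then show ?thesis
    using assms unfolding short_exact_iff bij_betw_def
    by (auto intro: mod_hom_comp comp_inj_on)
qed

lemma short_exact_iso_middle:
  assumes "left_module R B" "left_module R B'" "short_exact R A f B g C"
    and "\<phi> \<in> mod_hom R B B'" "bij_betw \<phi> (carrier B) (carrier B')"
  shows "short_exact R A (\<phi> \<circ> f) B' (g \<circ> inv_into (carrier B) \<phi>) C"
proof -
  have \<phi>: "inj_on \<phi> (carrier B)" "carrier B' = \<phi> ` carrier B"
    using assms(5) by (auto simp: bij_betw_def)
  have f: "f ` carrier A \<subseteq> carrier B"
    using assms(3) by (auto simp: short_exact_iff mod_hom_closed)
  show ?thesis
    unfolding short_exact_iff
  proof (intro conjI)
    show "\<phi> \<circ> f \<in> mod_hom R A B'" "g \<circ> inv_into (carrier B) \<phi> \<in> mod_hom R B' C"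
      using assms(3,4) mod_hom_inverse[OF assms(1,4,5)] mod_hom_comp
      by (auto simp: short_exact_iff)
    show "inj_on (\<phi> \<circ> f) (carrier A)"
      using assms(3) f \<phi> by (auto simp: short_exact_iff intro: comp_inj_on inj_on_subset)
    show "(g \<circ> inv_into (carrier B) \<phi>) ` carrier B' = carrier C"
      using assms(3) \<phi>(1) by (simp add: short_exact_iff \<phi>(2) image_image)
    show "\<forall>x\<in>carrier B'. (g \<circ> inv_into (carrier B) \<phi>) x = \<zero>\<^bsub>C\<^esub> \<longleftrightarrow> x \<in> (\<phi> \<circ> f) ` carrier A"
      using assms(3) f \<phi> by (auto simp: short_exact_iff image_image[symmetric] inj_on_image_mem_iff)
  qed
qed

lemma short_exact_submodule:
  assumes "left_module R B" "left_module R C" "f \<in> mod_hom R B C" "f ` carrier B = carrier C"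
  shows "short_exact R (B\<lparr>carrier := {x \<in> carrier B. f x = \<zero>\<^bsub>C\<^esub>}\<rparr>) (\<lambda>x. x) B f C"
  using assms mod_hom_incl[of "{x \<in> carrier B. f x = \<zero>\<^bsub>C\<^esub>}" "carrier B" R B]
  by (auto simp: short_exact_iff)

text \<open>A splitting is recorded as a complement of the kernel of \<open>g\<close>, not as a
  section. Complements over parts of \<open>X\<close> are ordered by inclusion, which prepares the
  use of Zorn's lemma.\<close>

definition splits :: "'r ring \<Rightarrow> ('r, 'e) module \<Rightarrow> ('e \<Rightarrow> 'x) \<Rightarrow> ('r, 'x) module \<Rightarrow> bool" where
  "splits R E g X \<longleftrightarrow> (\<exists>C. submodule C R E \<and> inj_on g C \<and> g ` C = carrier X)"

text \<open>Choose \<open>c\<close> in the complement with \<open>g c = g e\<close>; then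
  \<open>e\<close> minus \<open>c\<close> lies in the kernel of \<open>g\<close>, so it is
  \<open>f y\<close> for some \<open>y\<close>. This decomposition of \<open>e\<close> is unique,
  and the retraction reads off \<open>y\<close>.\<close>

lemma splits_retraction:
  assumes "left_module R Y" "left_module R E" "left_module R X"
    and ex: "short_exact R Y f E g X" and "splits R E g X"
  obtains \<rho> where "\<rho> \<in> mod_hom R E Y" "\<And>y. y \<in> carrier Y \<Longrightarrow> \<rho> (f y) = y"
proof -
  interpret Y: left_module R Y by fact
  interpret E: left_module R E by fact
  interpret X: left_module R X by fact
  obtain C where C: "submodule C R E" "inj_on g C" "g ` C = carrier X"
    using assms(5) by (auto simp: splits_def)
  note C_sub = E.submodule_subset[OF C(1)]
  have f: "f \<in> mod_hom R Y E" "inj_on f (carrier Y)" and g: "g \<in> mod_hom R E X"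
    and ker: "\<And>e. e \<in> carrier E \<Longrightarrow> g e = \<zero>\<^bsub>X\<^esub> \<longleftrightarrow> e \<in> f ` carrier Y"
    using ex by (auto simp: short_exact_iff)
  note fc = mod_hom_closed[OF f(1)] and gc = mod_hom_closed[OF g]
  have gf: "g (f y) = \<zero>\<^bsub>X\<^esub>" if "y \<in> carrier Y" for y
    using ker that fc by blast
  have ex: "\<exists>y c. y \<in> carrier Y \<and> c \<in> C \<and> e = f y \<oplus>\<^bsub>E\<^esub> c" if e: "e \<in> carrier E" for e
  proof -
    obtain c where c: "c \<in> C" "g c = g e"
      using C(3) gc[OF e] by (metis imageE)
    then have cE: "c \<in> carrier E" using C_sub by blast
    then have "g (e \<ominus>\<^bsub>E\<^esub> c) = \<zero>\<^bsub>X\<^esub>"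
      using mod_hom_eq_iff[OF assms(2,3) g e cE] c by simp
    then obtain y where "y \<in> carrier Y" "e \<ominus>\<^bsub>E\<^esub> c = f y"
      using ker e cE by (metis E.M.minus_closed imageE)
    with c e cE show ?thesis
      by (metis E.minus_add_cancel)
  qed
  have uniq: "y = y'" if "f y \<oplus>\<^bsub>E\<^esub> c = f y' \<oplus>\<^bsub>E\<^esub> c'" "y \<in> carrier Y" "y' \<in> carrier Y" "c \<in> C" "c' \<in> C"
    for y y' c c'
  proof -
    have cE: "c \<in> carrier E" "c' \<in> carrier E" using C_sub that by blast+
    have "g (f y \<oplus>\<^bsub>E\<^esub> c) = g c" "g (f y' \<oplus>\<^bsub>E\<^esub> c') = g c'"
      using that(2,3) cE fc gc by (simp_all add: mod_hom_add[OF g] gf)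
    then have "g c = g c'"
      using that(1) by simp
    then have "c = c'"
      using C(2) that by (metis inj_onD)
    then have "f y = f y'"
      using that cE fc by simp
    then show ?thesis
      using f(2) that by (metis inj_onD)
  qed
  define \<rho> where "\<rho> e = (THE y. y \<in> carrier Y \<and> (\<exists>c\<in>C. e = f y \<oplus>\<^bsub>E\<^esub> c))" for e
  have \<rho>: "\<rho> (f y \<oplus>\<^bsub>E\<^esub> c) = y" if "y \<in> carrier Y" "c \<in> C" for y c
    unfolding \<rho>_def using that uniq by (intro the_equality) blast+
  show ?thesis
  proof
    show "\<rho> \<in> mod_hom R E Y"
    proof (rule mod_homI)
      show "\<rho> e \<in> carrier Y" if "e \<in> carrier E" for e
        using ex[OF that] \<rho> by auto
      show "\<rho> (e \<oplus>\<^bsub>E\<^esub> e') = \<rho> e \<oplus>\<^bsub>Y\<^esub> \<rho> e'" if e: "e \<in> carrier E" "e' \<in> carrier E" for e e'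
      proof -
        obtain y c y' c' where *: "y \<in> carrier Y" "c \<in> C" "e = f y \<oplus>\<^bsub>E\<^esub> c"
          "y' \<in> carrier Y" "c' \<in> C" "e' = f y' \<oplus>\<^bsub>E\<^esub> c'"
          using ex[OF e(1)] ex[OF e(2)] by blast
        moreover have "c \<in> carrier E" "c' \<in> carrier E" using C_sub * by blast+
        ultimately have "e \<oplus>\<^bsub>E\<^esub> e' = f (y \<oplus>\<^bsub>Y\<^esub> y') \<oplus>\<^bsub>E\<^esub> (c \<oplus>\<^bsub>E\<^esub> c')"
          using fc by (simp add: mod_hom_add[OF f(1)] E.M.a_ac)
        then show ?thesis
          using * \<rho> E.submodule_add[OF C(1)] by simp
      qed
      show "\<rho> (a \<odot>\<^bsub>E\<^esub> e) = a \<odot>\<^bsub>Y\<^esub> \<rho> e" if e: "a \<in> carrier R" "e \<in> carrier E" for a e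
      proof -
        obtain y c where *: "y \<in> carrier Y" "c \<in> C" "e = f y \<oplus>\<^bsub>E\<^esub> c"
          using ex[OF e(2)] by blast
        moreover have "c \<in> carrier E" using C_sub * by blast
        ultimately have "a \<odot>\<^bsub>E\<^esub> e = f (a \<odot>\<^bsub>Y\<^esub> y) \<oplus>\<^bsub>E\<^esub> (a \<odot>\<^bsub>E\<^esub> c)"
          using fc e by (simp add: mod_hom_smult[OF f(1)] E.smult_r_distr)
        then show ?thesis
          using * e \<rho> E.submodule_smult[OF C(1)] by (simp add: Y.smult_closed)
      qed
    qed
    show "\<rho> (f y) = y" if "y \<in> carrier Y" for y
      using \<rho>[OF that E.submodule_zero[OF C(1)]] fc that by simp
  qed
qed

text \<open>Subtracting \<open>f (\<rho> e)\<close> from \<open>e\<close> moves \<open>e\<close>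
  into the kernel of \<open>\<rho>\<close> without changing \<open>g e\<close>, which gives
  surjectivity. Injectivity holds because the kernel of \<open>g\<close> is the image of
  \<open>f\<close>, on which \<open>\<rho>\<close> is injective.\<close>

lemma retraction_kernel:
  assumes "left_module R Y" "left_module R E" "left_module R X"
    and ex: "short_exact R Y f E g X"
    and \<rho>: "\<rho> \<in> mod_hom R E Y" "\<And>y. y \<in> carrier Y \<Longrightarrow> \<rho> (f y) = y"
  defines "C \<equiv> {e \<in> carrier E. \<rho> e = \<zero>\<^bsub>Y\<^esub>}"
  shows "submodule C R E" "inj_on g C" "g ` C = carrier X"
proof -
  interpret Y: left_module R Y by fact
  interpret E: left_module R E by fact
  interpret X: left_module R X by fact
  have f: "f \<in> mod_hom R Y E" and g: "g \<in> mod_hom R E X" "g ` carrier E = carrier X"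
    and ker: "\<And>e. e \<in> carrier E \<Longrightarrow> g e = \<zero>\<^bsub>X\<^esub> \<longleftrightarrow> e \<in> f ` carrier Y"
    using ex by (auto simp: short_exact_iff)
  note fc = mod_hom_closed[OF f(1)] and gc = mod_hom_closed[OF g(1)]
  have gf: "g (f y) = \<zero>\<^bsub>X\<^esub>" if "y \<in> carrier Y" for y
    using ker that fc by blast
  show "submodule C R E"
    unfolding C_def by (rule submodule_kernel[OF assms(2,1) \<rho>(1)])
  show "inj_on g C"
  proof (rule inj_onI)
    fix c c' assume c: "c \<in> C" "c' \<in> C" "g c = g c'"
    then have cE: "c \<in> carrier E" "c' \<in> carrier E" by (auto simp: C_def)
    then have "g (c \<ominus>\<^bsub>E\<^esub> c') = \<zero>\<^bsub>X\<^esub>"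
      using mod_hom_eq_iff[OF assms(2,3) g(1)] c(3) by simp
    then obtain y where y: "y \<in> carrier Y" "c \<ominus>\<^bsub>E\<^esub> c' = f y"
      using ker cE by (metis E.M.minus_closed imageE)
    have "\<rho> (c \<ominus>\<^bsub>E\<^esub> c') = \<zero>\<^bsub>Y\<^esub>"
      using mod_hom_eq_iff[OF assms(2,1) \<rho>(1) cE] c by (simp add: C_def)
    then have "c \<ominus>\<^bsub>E\<^esub> c' = \<zero>\<^bsub>E\<^esub>"
      using \<rho>(2) y mod_hom_zero[OF assms(1,2) f] by simp
    then show "c = c'"
      using E.minus_eq_zero_iff cE by simp
  qed
  show "g ` C = carrier X"
  proof
    show "carrier X \<subseteq> g ` C"
    proof
      fix x assume "x \<in> carrier X"
      then obtain e where e: "e \<in> carrier E" "x = g e"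
        using g(2) by (metis imageE)
      define y where "y = \<rho> e"
      have y: "y \<in> carrier Y"
        using e by (simp add: y_def mod_hom_closed[OF \<rho>(1)])
      have "\<rho> (e \<ominus>\<^bsub>E\<^esub> f y) = \<zero>\<^bsub>Y\<^esub>"
        using mod_hom_eq_iff[OF assms(2,1) \<rho>(1) e(1) fc[OF y]] \<rho>(2)[OF y] by (simp add: y_def)
      moreover have "g (e \<ominus>\<^bsub>E\<^esub> f y) = x"
        using mod_hom_minus[OF assms(2,3) g(1) e(1) fc[OF y]] gf[OF y] e gc
        by (simp add: a_minus_def X.M.add.inv_one[folded a_inv_def])
      ultimately show "x \<in> g ` C"
        using e fc[OF y] by (intro image_eqI[of _ _ "e \<ominus>\<^bsub>E\<^esub> f y"]) (auto simp: C_def)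
    qed
  qed (use gc in \<open>auto simp: C_def\<close>)
qed

text \<open>The morphism \<open>h\<close> combines a retraction \<open>\<rho>\<close> of the first
  extension with a section \<open>s\<close> of the second. The middle terms may live on different
  types, so one of them can be the direct sum.\<close>

lemma splits_ext_equiv:
  assumes "left_module R Y" "left_module R E" "left_module R X" "left_module R E'"
    and ex: "short_exact R Y f E g X" and ex': "short_exact R Y f' E' g' X"
    and "splits R E g X" "splits R E' g' X"
  shows "ext_equiv R Y (f, E, g) (f', E', g')"
proof -
  interpret Y: left_module R Y by fact
  interpret E: left_module R E by fact
  interpret X: left_module R X by fact
  interpret E': left_module R E' by fact
  obtain \<rho> where \<rho>: "\<rho> \<in> mod_hom R E Y" "\<And>y. y \<in> carrier Y \<Longrightarrow> \<rho> (f y) = y"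
    by (rule splits_retraction[OF assms(1-3) ex assms(7)]) (rule that)
  obtain C where C: "submodule C R E'" "inj_on g' C" "g' ` C = carrier X"
    using assms(8) by (auto simp: splits_def)
  have f: "f \<in> mod_hom R Y E" and g: "g \<in> mod_hom R E X"
    and gf: "\<And>y. y \<in> carrier Y \<Longrightarrow> g (f y) = \<zero>\<^bsub>X\<^esub>"
    using ex by (auto simp: short_exact_iff mod_hom_closed)
  have f': "f' \<in> mod_hom R Y E'" and g': "g' \<in> mod_hom R E' X"
    and g'f': "\<And>y. y \<in> carrier Y \<Longrightarrow> g' (f' y) = \<zero>\<^bsub>X\<^esub>"
    using ex' by (auto simp: short_exact_iff mod_hom_closed)
  define s where "s = inv_into C g'"
  have "s \<in> mod_hom R X (E'\<lparr>carrier := C\<rparr>)"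
    using mod_hom_inverse[OF E'.submodule_left_module[OF C(1)]
        mod_hom_restrict_dom[OF g' E'.submodule_subset[OF C(1)]]] C
    by (simp add: s_def bij_betw_def)
  then have s: "s \<in> mod_hom R X E'"
    using mod_hom_extend_codomain E'.submodule_subset[OF C(1)] by blast
  have g's: "g' (s x) = x" if "x \<in> carrier X" for x
    using that C(3) by (simp add: s_def f_inv_into_f)
  note closed = mod_hom_closed[OF f'] mod_hom_closed[OF g] mod_hom_closed[OF \<rho>(1)]
    mod_hom_closed[OF s] mod_hom_closed[OF f]
  define h where "h e = f' (\<rho> e) \<oplus>\<^bsub>E'\<^esub> s (g e)" for e
  have "h \<in> mod_hom R E E'"
    unfolding h_def
    by (rule mod_homI)
      (simp_all add: closed mod_hom_add[OF \<rho>(1)] mod_hom_add[OF f'] mod_hom_add[OF s]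
        mod_hom_add[OF g] mod_hom_smult[OF \<rho>(1)] mod_hom_smult[OF f'] mod_hom_smult[OF s]
        mod_hom_smult[OF g] E'.M.a_ac E'.smult_r_distr)
  moreover have "h (f y) = f' y" if "y \<in> carrier Y" for y
    using that by (simp add: h_def \<rho>(2) gf mod_hom_zero[OF assms(3,4) s] closed)
  moreover have "g' (h e) = g e" if "e \<in> carrier E" for e
    using that by (simp add: h_def mod_hom_add[OF g'] closed g'f' g's)
  ultimately show ?thesis
    by auto
qed

section \<open>Split extensions and the vanishing of \<open>Ext1\<close>\<close>

lemma mod_dsum_left_module:
  assumes "left_module R M" "left_module R N"
  shows "left_module R (mod_dsum M N)"
proof -
  interpret M: left_module R M by fact
  interpret N: left_module R N by fact
  have "\<exists>p'\<in>carrier (mod_dsum M N). p' \<oplus>\<^bsub>mod_dsum M N\<^esub> p = \<zero>\<^bsub>mod_dsum M N\<^esub>"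
    if "p \<in> carrier (mod_dsum M N)" for p
    using that
    by (intro bexI[of _ "(\<ominus>\<^bsub>M\<^esub> fst p, \<ominus>\<^bsub>N\<^esub> snd p)"])
      (auto simp: mod_dsum_def M.M.l_neg N.M.l_neg)
  then show ?thesis
    by (intro left_moduleI)
      (auto simp: mod_dsum_def M.smult_closed M.smult_l_distr M.smult_r_distr M.smult_assoc
        M.smult_one N.smult_closed N.smult_l_distr N.smult_r_distr N.smult_assoc
        N.smult_one M.M.a_ac N.M.a_ac M.R.ring_axioms)
qed

lemma
  assumes "left_module R X" "left_module R Y"
  shows split_ext_short_exact: "short_exact R Y (\<lambda>y. (y, \<zero>\<^bsub>X\<^esub>)) (mod_dsum Y X) snd X"
    and split_ext_splits: "splits R (mod_dsum Y X) snd X"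
proof -
  interpret X: left_module R X by fact
  interpret Y: left_module R Y by fact
  interpret D: left_module R "mod_dsum Y X" by (rule mod_dsum_left_module) fact+
  show "short_exact R Y (\<lambda>y. (y, \<zero>\<^bsub>X\<^esub>)) (mod_dsum Y X) snd X"
    unfolding short_exact_iff
    by (intro conjI mod_homI) (auto simp: mod_dsum_def X.smult_zero inj_on_def)
  have "submodule ({\<zero>\<^bsub>Y\<^esub>} \<times> carrier X) R (mod_dsum Y X)"
    by (rule D.submoduleI) (auto simp: mod_dsum_def Y.smult_zero X.smult_closed)
  moreover have "inj_on snd ({\<zero>\<^bsub>Y\<^esub>} \<times> carrier X)" "snd ` ({\<zero>\<^bsub>Y\<^esub>} \<times> carrier X) = carrier X"
    by (auto simp: inj_on_def)
  ultimately show "splits R (mod_dsum Y X) snd X"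
    unfolding splits_def by blast
qed

text \<open>A morphism to the split extension, followed by the first projection, is a retraction, so
  an extension in the zero class splits. Conversely, split extensions are pairwise equivalent and
  form a single class. From here on vanishing is used only in this form.\<close>

lemma (in smallness) Ext1_vanishes_iff:
  assumes "X \<in> RMod small R" "Y \<in> RMod small R"
  shows "Ext1_vanishes small R X Y \<longleftrightarrow>
    (\<forall>E\<in>RMod small R. \<forall>f g. short_exact R Y f E g X \<longrightarrow> splits R E g X)"
proof -
  let ?rel = "{(\<xi>, \<zeta>). \<xi> \<in> extensions small R X Y \<and> \<zeta> \<in> extensions small R X Y \<and> ext_equiv R Y \<xi> \<zeta>}"
  let ?ext = "extensions small R X Y"
  have X: "left_module R X" "small (carrier X)" and Y: "left_module R Y" "small (carrier Y)"
    using assms by (auto simp: RMod_def)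
  interpret X: left_module R X by fact
  interpret Y: left_module R Y by fact
  note D = mod_dsum_left_module[OF Y(1) X(1)]
  show ?thesis
  proof safe
    fix E f g
    assume van: "Ext1_vanishes small R X Y" and E: "E \<in> RMod small R"
      and ex: "short_exact R Y f E g X"
    have modE: "left_module R E" using E by (simp add: RMod_def)
    have mem: "(f, E, g) \<in> ?ext"
      using E ex by (simp add: extensions_def)
    then have "?rel `` {(f, E, g)} \<in> Ext1 small R X Y"
      unfolding Ext1_def by (rule quotientI)
    then have "?rel `` {(f, E, g)} = Ext1_zero small R X Y"
      using van by (simp only: Ext1_vanishes_def singleton_iff)
    moreover have "ext_equiv R Y (f, E, g) (f, E, g)"
      by (auto intro!: bexI[of _ "\<lambda>e. e"] mod_homI)
    ultimately have "(f, E, g) \<in> Ext1_zero small R X Y"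
      using mem by blast
    then obtain h where h: "h \<in> mod_hom R E (mod_dsum Y X)"
      "\<And>y. y \<in> carrier Y \<Longrightarrow> h (f y) = (y, \<zero>\<^bsub>X\<^esub>)"
      by (auto simp: Ext1_zero_def split_ext_def)
    have "fst \<in> mod_hom R (mod_dsum Y X) Y"
      by (rule mod_homI) (auto simp: mod_dsum_def)
    then have "fst \<circ> h \<in> mod_hom R E Y"
      using h(1) mod_hom_comp by blast
    from retraction_kernel[OF Y(1) modE X(1) ex this] h(2) show "splits R E g X"
      by (auto simp: splits_def)
  next
    assume split: "\<forall>E\<in>RMod small R. \<forall>f g. short_exact R Y f E g X \<longrightarrow> splits R E g X"
    have "of_small_size small (carrier (mod_dsum Y X))"
      using X(2) Y(2) of_small_size_Times[of "carrier Y" "carrier X"]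
      by (simp add: mod_dsum_def of_small_size_iff_small)
    then obtain E \<phi> where "E \<in> RMod small R" "\<phi> \<in> mod_hom R (mod_dsum Y X) E"
      "bij_betw \<phi> (carrier (mod_dsum Y X)) (carrier E)"
      using ex_iso_RMod[OF D] by blast
    \<comment> \<open>Without any extension on \<open>'u\<close> the quotient would be empty and not
      a singleton. The split extension lives on \<open>'u \<times> 'u\<close> and has to be copied
      into \<open>'u\<close> first.\<close>
    then have nonempty: "?ext \<noteq> {}"
      using short_exact_iso_middle[OF D _ split_ext_short_exact[OF X(1) Y(1)]]
      by (fastforce simp: extensions_def RMod_def)
    have ext: "left_module R E \<and> short_exact R Y f E g X \<and> splits R E g X" if "(f, E, g) \<in> ?ext" for f E g
      using that split by (auto simp: extensions_def RMod_def)
    have "ext_equiv R Y \<xi> (split_ext X Y)" if "\<xi> \<in> ?ext" for \<xi>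
    proof -
      obtain f E g where \<xi>: "\<xi> = (f, E, g)" by (cases \<xi>)
      show ?thesis
        unfolding \<xi> split_ext_def using ext[of f E g] that[unfolded \<xi>]
        by (intro splits_ext_equiv[OF Y(1) _ X(1)] X(1) Y(1) D split_ext_short_exact split_ext_splits) auto
    qed
    then have zero: "Ext1_zero small R X Y = ?ext"
      by (auto simp: Ext1_zero_def)
    have "ext_equiv R Y \<xi> \<zeta>" if "\<xi> \<in> ?ext" "\<zeta> \<in> ?ext" for \<xi> \<zeta>
    proof -
      obtain f E g f' E' g' where eq: "\<xi> = (f, E, g)" "\<zeta> = (f', E', g')" by (cases \<xi>, cases \<zeta>)
      show ?thesis
        unfolding eq using ext[of f E g] ext[of f' E' g'] that[unfolded eq]
        by (intro splits_ext_equiv[OF Y(1) _ X(1)]) auto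
    qed
    then have "?rel `` {\<xi>} = ?ext" if "\<xi> \<in> ?ext" for \<xi>
      using that by blast
    then have "Ext1 small R X Y = {?ext}"
      using nonempty by (auto simp: Ext1_def quotient_def)
    then show "Ext1_vanishes small R X Y"
      by (simp add: Ext1_vanishes_def zero)
  qed
qed

section \<open>The left class of a thick cotorsion pair\<close>

text \<open>
  Orthogonality makes sense for a module \<open>X\<close> over any carrier type as long as the middle terms of
  the extensions of \<open>X\<close> have elements of type \<^typ>\<open>'u\<close>. Direct sums and their submodules therefore
  never need to be encoded in \<^typ>\<open>'u\<close>.
\<close>

definition ext_orthogonal :: "('u set \<Rightarrow> bool) \<Rightarrow> 'r ring \<Rightarrow> ('r, 'u) module set \<Rightarrow>
    ('r, 'x) module \<Rightarrow> bool" where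
  "ext_orthogonal small R \<F> X \<longleftrightarrow> left_module R X \<and> of_small_size small (carrier X) \<and>
     (\<forall>Y\<in>\<F>. \<forall>E\<in>RMod small R. \<forall>f g. short_exact R Y f E g X \<longrightarrow> splits R E g X)"

text \<open>Composition with the inverse isomorphism turns an extension of \<open>X'\<close> into
  one of \<open>X\<close> with the same middle term, and the complement found there serves for
  \<open>X'\<close> unchanged.\<close>

lemma (in smallness) ext_orthogonal_iso:
  assumes X: "ext_orthogonal small R \<F> X" and X': "left_module R X'"
    and \<phi>: "\<phi> \<in> mod_hom R X X'" "bij_betw \<phi> (carrier X) (carrier X')"
  shows "ext_orthogonal small R \<F> X'"
  unfolding ext_orthogonal_def
proof (intro conjI ballI allI impI)
  have modX: "left_module R X" and size: "of_small_size small (carrier X)"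
    using X by (auto simp: ext_orthogonal_def)
  show "left_module R X'" by fact
  show "of_small_size small (carrier X')"
    using of_small_size_image[OF size, of \<phi>] \<phi>(2) by (simp add: bij_betw_def)
  fix Y E f g assume *: "Y \<in> \<F>" "E \<in> RMod small R" "short_exact R Y f E g X'"
  define \<psi> where "\<psi> = inv_into (carrier X) \<phi>"
  have \<psi>: "\<psi> \<in> mod_hom R X' X" "bij_betw \<psi> (carrier X') (carrier X)"
    unfolding \<psi>_def using mod_hom_inverse[OF modX \<phi>] bij_betw_inv_into[OF \<phi>(2)] by auto
  have "short_exact R Y f E (\<psi> \<circ> g) X"
    by (rule short_exact_iso_right[OF X' modX *(3) \<psi>])
  then obtain C where C: "submodule C R E" "inj_on (\<psi> \<circ> g) C" "(\<psi> \<circ> g) ` C = carrier X"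
    using X * unfolding ext_orthogonal_def splits_def by blast
  have modE: "left_module R E"
    using * by (simp add: RMod_def)
  have "g ` C \<subseteq> carrier X'"
    using left_module.submodule_subset[OF modE C(1)] *(3)
    by (auto simp: short_exact_iff subset_iff mod_hom_closed)
  moreover have "\<psi> ` (g ` C) = \<psi> ` carrier X'"
    using C(3) \<psi>(2) by (simp add: bij_betw_def image_comp)
  ultimately have "g ` C = carrier X'"
    using \<psi>(2) inj_on_image_eq_iff[of \<psi> "carrier X'" "g ` C" "carrier X'"]
    by (auto simp: bij_betw_def)
  moreover have "inj_on g C"
    using C(2) by (rule inj_on_imageI2)
  ultimately show "splits R E g X'"
    using C(1) by (auto simp: splits_def)
qed

locale thick_cotorsion_pair = smallness small
  for small :: "'u set \<Rightarrow> bool" +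
  fixes R :: "'r ring" and \<W> \<F> :: "('r, 'u) module set"
  assumes cotorsion: "cotorsion_pair small R \<W> \<F>" and thick: "thick small R \<W>"
begin

abbreviation orth :: "('r, 'x) module \<Rightarrow> bool" where
  "orth \<equiv> ext_orthogonal small R \<F>"

lemma orthD:
  assumes "orth X"
  shows "left_module R X" "of_small_size small (carrier X)"
  using assms by (auto simp: ext_orthogonal_def)

lemma left_class_RMod: "\<W> \<subseteq> RMod small R"
  using cotorsion unfolding cotorsion_pair_def by blast

lemma right_class_RMod: "\<F> \<subseteq> RMod small R"
proof -
  have "\<F> = {Y \<in> RMod small R. \<forall>W\<in>\<W>. Ext1_vanishes small R W Y}"
    using cotorsion unfolding cotorsion_pair_def by (rule conjunct1)
  then show ?thesis by blast
qed

lemma orth_iff: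
  assumes "X \<in> RMod small R"
  shows "orth X \<longleftrightarrow> X \<in> \<W>"
proof -
  have "\<W> = {X \<in> RMod small R. \<forall>Y\<in>\<F>. Ext1_vanishes small R X Y}"
    using cotorsion unfolding cotorsion_pair_def by (rule conjunct2)
  then have "X \<in> \<W> \<longleftrightarrow> (\<forall>Y\<in>\<F>. Ext1_vanishes small R X Y)"
    using assms by blast
  also have "\<dots> \<longleftrightarrow> (\<forall>Y\<in>\<F>. \<forall>E\<in>RMod small R. \<forall>f g. short_exact R Y f E g X \<longrightarrow> splits R E g X)"
    using Ext1_vanishes_iff[OF assms] right_class_RMod by blast
  finally show ?thesis
    using assms by (auto simp: ext_orthogonal_def RMod_def of_small_size_iff_small)
qed

lemma ex_iso_orth_iff:
  fixes M :: "('r, 'x) module"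
  assumes "left_module R M" "of_small_size small (carrier M)"
  obtains N \<phi> where "N \<in> RMod small R" "\<phi> \<in> mod_hom R M N" "bij_betw \<phi> (carrier M) (carrier N)"
    "orth M \<longleftrightarrow> N \<in> \<W>"
proof -
  obtain N \<phi> where N: "N \<in> RMod small R" "\<phi> \<in> mod_hom R M N" "bij_betw \<phi> (carrier M) (carrier N)"
    using ex_iso_RMod[OF assms] .
  then have modN: "left_module R N"
    by (simp add: RMod_def)
  have "orth M \<longleftrightarrow> orth N"
    using ext_orthogonal_iso[of R \<F> M N, OF _ modN N(2,3)]
      ext_orthogonal_iso[of R \<F> N M, OF _ assms(1) mod_hom_inverse[OF assms(1) N(2,3)]
        bij_betw_inv_into[OF N(3)]]
    by blast
  with N that orth_iff[OF N(1)] show ?thesis by blast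
qed

text \<open>Thickness is assumed for modules on \<open>'u\<close> only. The three terms, possibly on
  three different types, are replaced by isomorphic copies there, for which orthogonality is
  membership in \<open>\<W>\<close>.\<close>

lemma orth_thick:
  fixes A :: "('r, 'x) module" and B :: "('r, 'y) module" and C :: "('r, 'z) module"
  assumes A: "left_module R A" "of_small_size small (carrier A)"
    and B: "left_module R B" "of_small_size small (carrier B)"
    and C: "left_module R C" "of_small_size small (carrier C)"
    and ex: "short_exact R A f B g C"
  shows "orth A \<Longrightarrow> orth B \<Longrightarrow> orth C" and "orth A \<Longrightarrow> orth C \<Longrightarrow> orth B"
    and "orth B \<Longrightarrow> orth C \<Longrightarrow> orth A"
proof -
  obtain A' \<alpha> where A': "A' \<in> RMod small R" "\<alpha> \<in> mod_hom R A A'" "bij_betw \<alpha> (carrier A) (carrier A')"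
    "orth A \<longleftrightarrow> A' \<in> \<W>" using ex_iso_orth_iff[OF A] .
  obtain B' \<beta> where B': "B' \<in> RMod small R" "\<beta> \<in> mod_hom R B B'" "bij_betw \<beta> (carrier B) (carrier B')"
    "orth B \<longleftrightarrow> B' \<in> \<W>" using ex_iso_orth_iff[OF B] .
  obtain C' \<gamma> where C': "C' \<in> RMod small R" "\<gamma> \<in> mod_hom R C C'" "bij_betw \<gamma> (carrier C) (carrier C')"
    "orth C \<longleftrightarrow> C' \<in> \<W>" using ex_iso_orth_iff[OF C] .
  have mods: "left_module R A'" "left_module R B'" "left_module R C'"
    using A' B' C' by (auto simp: RMod_def)
  have "\<exists>f g. short_exact R A' f B' g C'"
    using short_exact_iso_left[OF short_exact_iso_middle[OF B(1) mods(2)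
          short_exact_iso_right[OF C(1) mods(3) ex C'(2,3)] B'(2,3)]
          mod_hom_inverse[OF A(1) A'(2,3)] bij_betw_inv_into[OF A'(3)]]
    by blast
  then have "(A' \<in> \<W> \<and> B' \<in> \<W> \<longrightarrow> C' \<in> \<W>) \<and> (A' \<in> \<W> \<and> C' \<in> \<W> \<longrightarrow> B' \<in> \<W>) \<and>
      (B' \<in> \<W> \<and> C' \<in> \<W> \<longrightarrow> A' \<in> \<W>)"
    using thick A'(1) B'(1) C'(1) unfolding thick_def by blast
  then have *: "(orth A \<and> orth B \<longrightarrow> orth C) \<and> (orth A \<and> orth C \<longrightarrow> orth B) \<and>
      (orth B \<and> orth C \<longrightarrow> orth A)"
    unfolding A'(4) B'(4) C'(4) .
  show "orth A \<Longrightarrow> orth B \<Longrightarrow> orth C" using * by blast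
  show "orth A \<Longrightarrow> orth C \<Longrightarrow> orth B" using * by blast
  show "orth B \<Longrightarrow> orth C \<Longrightarrow> orth A" using * by blast
qed

text \<open>Two out of three is used here for the third term of the sequence. This serves twice: for
  the successive quotients of the kernels, and for the direct limit as a quotient of the direct
  sum.\<close>

lemma orth_quotient:
  fixes M :: "('r, 'x) module"
  assumes M: "orth M" and H: "submodule H R M" "orth (M\<lparr>carrier := H\<rparr>)"
  obtains Q :: "('r, 'x) module" and p
  where "orth Q" "p \<in> mod_hom R M Q" "carrier Q = p ` carrier M"
    "\<And>x. x \<in> carrier M \<Longrightarrow> p x = \<zero>\<^bsub>Q\<^esub> \<longleftrightarrow> x \<in> H"
proof -
  interpret M: left_module R M using M by (rule orthD)
  obtain Q :: "('r, 'x) module" and p where Q: "left_module R Q" "p \<in> mod_hom R M Q"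
    "carrier Q = p ` carrier M" "\<And>x. x \<in> carrier M \<Longrightarrow> p x = \<zero>\<^bsub>Q\<^esub> \<longleftrightarrow> x \<in> H"
    by (rule quotient_module[OF orthD(1)[OF M] H(1)]) (rule that)
  have "{x \<in> carrier M. p x = \<zero>\<^bsub>Q\<^esub>} = H"
    using Q(4) M.submodule_subset[OF H(1)] by blast
  then have "short_exact R (M\<lparr>carrier := H\<rparr>) (\<lambda>x. x) M p Q"
    using short_exact_submodule[OF orthD(1)[OF M] Q(1,2)] Q(3) by simp
  then have "orth Q"
    using orth_thick(1)[OF orthD[OF H(2)] orthD[OF M] Q(1)] H M Q(3) orthD(2)[OF M]
    by (simp add: of_small_size_image)
  with Q that show ?thesis by blast
qed

text \<open>
  A variant of Eklof's lemma. An extension of \<open>X\<close> by \<open>Y\<close> is split by Zorn's lemma, applied to the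
  submodules of the middle term that map bijectively onto some member of the filtration.
\<close>

lemma orth_filtration:
  fixes X :: "('r, 'x) module"
  assumes X: "left_module R X" "of_small_size small (carrier X)"
    and sub: "\<And>N. N \<in> \<C> \<Longrightarrow> submodule N R X"
    and zero: "{\<zero>\<^bsub>X\<^esub>} \<in> \<C>"
    and Union: "\<And>\<D>. \<lbrakk>\<D> \<noteq> {}; subset.chain \<C> \<D>\<rbrakk> \<Longrightarrow> \<Union>\<D> \<in> \<C>"
    and step: "\<And>N. \<lbrakk>N \<in> \<C>; N \<noteq> carrier X\<rbrakk> \<Longrightarrow> \<exists>N' \<in> \<C>. N \<subset> N' \<and>
      (\<exists>(Q :: ('r, 'q) module) q. orth Q \<and> q \<in> mod_hom R (X\<lparr>carrier := N'\<rparr>) Q \<and>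
        q ` N' = carrier Q \<and> (\<forall>x\<in>N'. q x = \<zero>\<^bsub>Q\<^esub> \<longleftrightarrow> x \<in> N))"
  shows "orth X"
  unfolding ext_orthogonal_def
proof (intro conjI ballI allI impI)
  fix Y E f g assume Y: "Y \<in> \<F>" and E: "E \<in> RMod small R" and ex: "short_exact R Y f E g X"
  have modY: "left_module R Y" and modE: "left_module R E" and smallE: "small (carrier E)"
    using Y E right_class_RMod by (auto simp: RMod_def)
  interpret X: left_module R X by fact
  interpret E: left_module R E by fact
  interpret Y: left_module R Y by fact
  have f: "f \<in> mod_hom R Y E" "inj_on f (carrier Y)"
    and g: "g \<in> mod_hom R E X" "g ` carrier E = carrier X"
    and ker: "\<And>e. e \<in> carrier E \<Longrightarrow> g e = \<zero>\<^bsub>X\<^esub> \<longleftrightarrow> e \<in> f ` carrier Y"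
    using ex by (auto simp: short_exact_iff)
  note fc = mod_hom_closed[OF f(1)] and gc = mod_hom_closed[OF g(1)]
  have gf: "g (f y) = \<zero>\<^bsub>X\<^esub>" if "y \<in> carrier Y" for y
    using ker that fc by blast
  define \<S> where "\<S> = {C. submodule C R E \<and> inj_on g C \<and> g ` C \<in> \<C>}"
  have "{\<zero>\<^bsub>E\<^esub>} \<in> \<S>"
    using zero E.submodule_zero_set mod_hom_zero[OF modE X(1) g(1)] by (simp add: \<S>_def)
  moreover have "\<Union>\<D> \<in> \<S>" if \<D>: "\<D> \<noteq> {}" "subset.chain \<S> \<D>" for \<D>
  proof -
    have chain: "\<And>A B. \<lbrakk>A \<in> \<D>; B \<in> \<D>\<rbrakk> \<Longrightarrow> A \<subseteq> B \<or> B \<subseteq> A" and sub\<D>: "\<D> \<subseteq> \<S>"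
      using \<D>(2) by (auto simp: subset_chain_def)
    have "submodule (\<Union>\<D>) R E"
      using \<D>(1) chain sub\<D> by (intro E.submodule_Union_chain) (auto simp: \<S>_def)
    moreover have "inj_on g (\<Union>A\<in>\<D>. A)"
      using chain sub\<D> by (intro inj_on_UNION_chain) (auto simp: \<S>_def)
    moreover have "\<Union>((`) g ` \<D>) \<in> \<C>"
    proof (rule Union)
      have "(`) g ` \<D> \<subseteq> \<C>"
        using sub\<D> by (auto simp: \<S>_def)
      moreover have "g ` A \<subseteq> g ` B \<or> g ` B \<subseteq> g ` A" if "A \<in> \<D>" "B \<in> \<D>" for A B
        using chain[OF that] by (metis image_mono)
      ultimately show "subset.chain \<C> ((`) g ` \<D>)"
        unfolding subset_chain_def by blast
    qed (use \<D>(1) in simp)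
    ultimately show ?thesis
      by (simp add: \<S>_def image_Union)
  qed
  ultimately obtain C where C: "C \<in> \<S>" "\<And>C'. \<lbrakk>C' \<in> \<S>; C \<subseteq> C'\<rbrakk> \<Longrightarrow> C' = C"
    using subset_Zorn_nonempty[of \<S>] by blast
  have subC: "submodule C R E" and injC: "inj_on g C" and gC: "g ` C \<in> \<C>"
    using C(1) by (auto simp: \<S>_def)
  have "g ` C = carrier X"
  proof (rule ccontr)
    assume "g ` C \<noteq> carrier X"
    then obtain N' and Q :: "('r, 'q) module" and q where N': "N' \<in> \<C>" "g ` C \<subset> N'"
      and Q: "orth Q" and q: "q \<in> mod_hom R (X\<lparr>carrier := N'\<rparr>) Q" "q ` N' = carrier Q"
      "\<And>x. x \<in> N' \<Longrightarrow> q x = \<zero>\<^bsub>Q\<^esub> \<longleftrightarrow> x \<in> g ` C"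
      using step[OF gC] by metis
    note modQ = orthD(1)[OF Q]
    note modN' = X.submodule_left_module[OF sub[OF N'(1)]]
    \<comment> \<open>The extension is pulled back to \<open>N'\<close> and then divided by the
      maximal partial complement \<open>C\<close>. What remains is an extension of \<open>Q\<close>
      by \<open>Y\<close>, where \<open>Q\<close> is \<open>N'\<close> modulo the image of
      \<open>C\<close>. Its splitting enlarges \<open>C\<close>.\<close>
    define H where "H = {e \<in> carrier E. g e \<in> N'}"
    have subH: "submodule H R E"
      unfolding H_def by (rule submodule_vimage[OF modE X(1) g(1) sub[OF N'(1)]])
    define E' where "E' = E\<lparr>carrier := H\<rparr>"
    have E'[simp]: "carrier E' = H" "\<zero>\<^bsub>E'\<^esub> = \<zero>\<^bsub>E\<^esub>" "add E' = add E" "smult E' = smult E"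
      by (auto simp: E'_def)
    have modE': "left_module R E'"
      unfolding E'_def by (rule E.submodule_left_module[OF subH])
    have HE: "H \<subseteq> carrier E" by (auto simp: H_def)
    have CH: "C \<subseteq> H"
      using N'(2) E.submodule_subset[OF subC] by (auto simp: H_def)
    have subC': "submodule C R E'"
      unfolding E'_def by (rule E.submodule_restrict[OF subH subC CH])
    obtain P :: "('r, 'u) module" and p where P: "left_module R P" "p \<in> mod_hom R E' P"
      "carrier P = p ` H" "\<And>x. x \<in> H \<Longrightarrow> p x = \<zero>\<^bsub>P\<^esub> \<longleftrightarrow> x \<in> C"
      by (rule quotient_module[OF modE' subC']) (use that in simp)
    \<comment> \<open>Orthogonality of \<open>Q\<close> concerns small middle terms on
      \<open>'u\<close>. \<open>P\<close> is one, being a quotient of a submodule of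
      \<open>E\<close> on the same type.\<close>
    have smallP: "P \<in> RMod small R"
      using P(1,3) small_image[OF small_subset[OF smallE HE]] by (simp add: RMod_def)
    have fH: "f y \<in> H" if "y \<in> carrier Y" for y
      using that fc gf X.submodule_zero[OF sub[OF N'(1)]] by (simp add: H_def)
    have f': "f \<in> mod_hom R Y E'"
      using f(1) fH by (auto simp: mod_hom_def hom_def)
    have g': "g \<in> mod_hom R E' (X\<lparr>carrier := N'\<rparr>)"
      unfolding E'_def by (rule mod_hom_restrict[OF g(1) HE]) (simp add: H_def)
    have gH: "g ` H = N'"
      using g(2) X.submodule_subset[OF sub[OF N'(1)]] by (auto simp: H_def)
    obtain k where k: "k \<in> mod_hom R P Q" "\<And>e. e \<in> H \<Longrightarrow> k (p e) = q (g e)"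
    proof (rule mod_hom_factor[OF modE' P(1) modQ P(2) _ mod_hom_comp[OF g' q(1)]])
      show "carrier P = p ` carrier E'" using P(3) by simp
      show "(q \<circ> g) x = \<zero>\<^bsub>Q\<^esub>" if "x \<in> carrier E'" "p x = \<zero>\<^bsub>P\<^esub>" for x
        using that P(4)[of x] q(3)[of "g x"] CH by (auto simp: H_def)
    qed (use that in auto)
    have "short_exact R Y (p \<circ> f) P k Q"
      unfolding short_exact_iff
    proof (intro conjI ballI)
      show "p \<circ> f \<in> mod_hom R Y P"
        by (rule mod_hom_comp[OF f' P(2)])
      show "inj_on (p \<circ> f) (carrier Y)"
        unfolding mod_hom_inj_on_iff[OF modY P(1) mod_hom_comp[OF f' P(2)]]
      proof (intro ballI impI)
        \<comment> \<open>\<open>C\<close> meets the image of \<open>f\<close> only in zero, since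
          \<open>g\<close> is injective on \<open>C\<close> and vanishes on that image.\<close>
        fix y assume y: "y \<in> carrier Y" "(p \<circ> f) y = \<zero>\<^bsub>P\<^esub>"
        then have "f y \<in> C"
          using P(4)[OF fH] by simp
        moreover have "g (f y) = g \<zero>\<^bsub>E\<^esub>"
          using gf[OF y(1)] mod_hom_zero[OF modE X(1) g(1)] by simp
        ultimately have "f y = \<zero>\<^bsub>E\<^esub>"
          using injC E.submodule_zero[OF subC] by (metis inj_onD)
        then show "y = \<zero>\<^bsub>Y\<^esub>"
          using mod_hom_inj_on_iff[OF modY modE f(1)] f(2) y(1) by blast
      qed
      have "k ` carrier P = q ` (g ` H)"
        using k(2) by (simp add: P(3) image_image)
      then show "k ` carrier P = carrier Q"
        using gH q(2) by simp
    next
      fix z assume "z \<in> carrier P"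
      then obtain e where e: "e \<in> H" "z = p e"
        using P(3) by auto
      show "k z = \<zero>\<^bsub>Q\<^esub> \<longleftrightarrow> z \<in> (p \<circ> f) ` carrier Y"
      proof
        assume "k z = \<zero>\<^bsub>Q\<^esub>"
        then have "g e \<in> g ` C"
          using k(2)[OF e(1)] q(3)[of "g e"] e by (simp add: H_def)
        then obtain c where c: "c \<in> C" "g e = g c" by auto
        then have cE: "c \<in> carrier E" "e \<in> carrier E"
          using CH HE e by auto
        then have "g (e \<ominus>\<^bsub>E\<^esub> c) = \<zero>\<^bsub>X\<^esub>"
          using mod_hom_eq_iff[OF modE X(1) g(1)] c(2) by simp
        then obtain y where y: "y \<in> carrier Y" "e \<ominus>\<^bsub>E\<^esub> c = f y"
          using ker[of "e \<ominus>\<^bsub>E\<^esub> c"] cE by auto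
        have "e = f y \<oplus>\<^bsub>E\<^esub> c"
          using E.minus_add_cancel[OF cE(2,1)] y(2) by simp
        then have "p e = p (f y) \<oplus>\<^bsub>P\<^esub> p c"
          using mod_hom_add[OF P(2), of "f y" c] fH[OF y(1)] c CH by auto
        moreover have "p c = \<zero>\<^bsub>P\<^esub>"
          using P(4) c CH by blast
        moreover have "p (f y) \<in> carrier P"
          using P(3) fH[OF y(1)] by simp
        ultimately have "z = p (f y)"
          using e(2) P(1) by (simp add: left_module_def abelian_group_def abelian_monoid.r_zero)
        then show "z \<in> (p \<circ> f) ` carrier Y"
          using y(1) by auto
      next
        assume "z \<in> (p \<circ> f) ` carrier Y"
        then obtain y where y: "y \<in> carrier Y" "z = p (f y)" by auto
        then have "k z = q \<zero>\<^bsub>X\<^esub>"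
          using k(2) fH gf by simp
        then show "k z = \<zero>\<^bsub>Q\<^esub>"
          using mod_hom_zero[OF modN' modQ q(1)] by simp
      qed
    qed (rule k(1))
    moreover from this have "splits R P k Q"
      using Q Y smallP by (auto simp: ext_orthogonal_def)
    ultimately obtain \<rho> where \<rho>: "\<rho> \<in> mod_hom R P Y" "\<And>y. y \<in> carrier Y \<Longrightarrow> \<rho> ((p \<circ> f) y) = y"
      using splits_retraction[OF modY P(1) modQ] by blast
    have "short_exact R Y f E' g (X\<lparr>carrier := N'\<rparr>)"
      using f' g' f(2) gH ker HE by (auto simp: short_exact_iff)
    \<comment> \<open>\<open>\<rho> \<circ> p\<close> retracts \<open>H\<close> onto
      \<open>Y\<close>. Its kernel is a complement over \<open>N'\<close>, and it contains
      \<open>C\<close> because \<open>p\<close> annihilates \<open>C\<close>; this contradicts the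
      maximality of \<open>C\<close>.\<close>
    note C' = retraction_kernel[OF modY modE' modN' this mod_hom_comp[OF P(2) \<rho>(1)]]
    define C' where "C' = {e \<in> H. \<rho> (p e) = \<zero>\<^bsub>Y\<^esub>}"
    have C': "submodule C' R E" "inj_on g C'" "g ` C' = N'"
      using C' \<rho>(2) E.submodule_trans[OF subH] by (auto simp: C'_def E'_def)
    have "p c = \<zero>\<^bsub>P\<^esub>" if "c \<in> C" for c
      using that P(4)[of c] CH by blast
    then have "C \<subseteq> C'"
      using CH mod_hom_zero[OF P(1) modY \<rho>(1)] by (auto simp: C'_def)
    with C(2)[of C'] C' N' show False
      by (auto simp: \<S>_def)
  qed
  with subC injC show "splits R E g X"
    by (auto simp: splits_def)
qed (fact X)+

end

section \<open>Transfinite extensions along a well-order\<close>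

context thick_cotorsion_pair
begin

text \<open>The form of Eklof's lemma that is applied both to direct sums and to the kernels. The
  filtration consists of the values of \<open>V\<close> on initial segments of \<open>A\<close>;
  finitariness of \<open>V\<close> makes it continuous, and each step adds one element
  \<open>a\<close>.\<close>

lemma orth_transfinite_extension:
  fixes X :: "('r, 'x) module" and V :: "'j set \<Rightarrow> 'x set"
  assumes X: "left_module R X" "of_small_size small (carrier X)"
    and wo: "well_order_on A r"
    and sub: "\<And>B. B \<subseteq> A \<Longrightarrow> submodule (V B) R X"
    and V_empty: "V {} = {\<zero>\<^bsub>X\<^esub>}" and V_top: "V A = carrier X"
    and V_mono: "\<And>B B'. \<lbrakk>B \<subseteq> B'; B' \<subseteq> A\<rbrakk> \<Longrightarrow> V B \<subseteq> V B'"
    and V_finitary: "\<And>B x. \<lbrakk>B \<subseteq> A; x \<in> V B\<rbrakk> \<Longrightarrow> \<exists>F\<in>Fpow B. x \<in> V F"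
    and step: "\<And>a. a \<in> A \<Longrightarrow> \<exists>(Q :: ('r, 'q) module) q. orth Q \<and>
      q \<in> mod_hom R (X\<lparr>carrier := V (under r a)\<rparr>) Q \<and> q ` V (under r a) = carrier Q \<and>
      (\<forall>x\<in>V (under r a). q x = \<zero>\<^bsub>Q\<^esub> \<longleftrightarrow> x \<in> V (underS r a))"
  shows "orth X"
proof -
  \<comment> \<open>Down-closed subsets, \<open>A\<close> included, take the place of ordinals. They
    form a chain that is closed under unions, so limit stages need no separate treatment.\<close>
  define \<B> where "\<B> = {B. B \<subseteq> A \<and> (\<forall>b\<in>B. under r b \<subseteq> B)}"
  have total: "a = b \<or> (a, b) \<in> r \<or> (b, a) \<in> r" if "a \<in> A" "b \<in> A" for a b
    using wo that by (auto simp: well_order_on_def linear_order_on_def total_on_def)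
  have refl: "(a, a) \<in> r" if "a \<in> A" for a
    using wo that
    by (auto simp: well_order_on_def linear_order_on_def partial_order_on_def preorder_on_def refl_on_def)
  have trans: "trans r" and wf: "wf (r - Id)"
    using wo by (auto simp: well_order_on_def linear_order_on_def partial_order_on_def preorder_on_def)
  note dom = well_order_on_domain[OF wo]
  have \<B>_A: "B \<subseteq> A" if "B \<in> \<B>" for B
    using that by (simp add: \<B>_def)
  have \<B>_chain: "B \<subseteq> B' \<or> B' \<subseteq> B" if B: "B \<in> \<B>" "B' \<in> \<B>" for B B'
  proof (rule ccontr)
    assume "\<not> ?thesis"
    then obtain b b' where b: "b \<in> B" "b \<notin> B'" "b' \<in> B'" "b' \<notin> B" by blast
    then have "(b, b') \<in> r \<or> (b', b) \<in> r"
      using total[of b b'] \<B>_A B by blast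
    then show False
      using b B unfolding \<B>_def under_def by blast
  qed
  have \<B>_Union: "\<Union>\<D> \<in> \<B>" if "\<D> \<subseteq> \<B>" for \<D>
    using that unfolding \<B>_def by blast
  \<comment> \<open>\<open>V\<close> may take the same value on several segments, so a family of
    values is pulled back to all segments that realise it. A finite subset of their union lies in a
    single one, and finitariness then puts each element into a member of
    \<open>\<D>\<close>.\<close>
  have V_Union: "V (\<Union>{B \<in> \<B>. V B \<in> \<D>}) = \<Union>\<D>" if \<D>: "\<D> \<noteq> {}" "\<D> \<subseteq> V ` \<B>" for \<D>
  proof
    let ?\<B> = "{B \<in> \<B>. V B \<in> \<D>}"
    have "?\<B> \<noteq> {}" using \<D> by blast
    moreover have chain: "subset.chain \<B> ?\<B>"
      using \<B>_chain by (auto simp: subset_chain_def)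
    moreover have "\<Union>?\<B> \<subseteq> A" using \<B>_A by blast
    ultimately show "V (\<Union>?\<B>) \<subseteq> \<Union>\<D>"
    proof (intro subsetI)
      fix x assume "x \<in> V (\<Union>?\<B>)"
      then obtain F where F: "F \<in> Fpow (\<Union>?\<B>)" "x \<in> V F"
        using V_finitary[OF \<open>\<Union>?\<B> \<subseteq> A\<close>] by blast
      then obtain B where "B \<in> ?\<B>" "F \<subseteq> B"
        using finite_subset_Union_chain[OF _ _ \<open>?\<B> \<noteq> {}\<close> chain, of F] by (auto simp: Fpow_def)
      then show "x \<in> \<Union>\<D>"
        using F(2) V_mono[of F B] \<B>_A[of B] by blast
    qed
    show "\<Union>\<D> \<subseteq> V (\<Union>?\<B>)"
    proof
      fix x assume "x \<in> \<Union>\<D>"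
      then obtain B where "B \<in> ?\<B>" "x \<in> V B" using \<D>(2) by blast
      then show "x \<in> V (\<Union>?\<B>)"
        using V_mono[of B "\<Union>?\<B>"] \<open>\<Union>?\<B> \<subseteq> A\<close> by blast
    qed
  qed
  have \<B>_next: "\<exists>a\<in>A. B = underS r a \<and> a \<notin> B \<and> under r a \<in> \<B>" if B: "B \<in> \<B>" "B \<noteq> A" for B
  proof -
    have "A - B \<noteq> {}" using B \<B>_A by blast
    \<comment> \<open>The least element outside \<open>B\<close>. Everything strictly below it is in
      \<open>B\<close>, and \<open>B\<close>, being down-closed, contains nothing above it.\<close>
    then obtain a where a: "a \<in> A - B" "\<And>b. (b, a) \<in> r - Id \<Longrightarrow> b \<notin> A - B"
      using wfE_min'[OF wf] by metis
    have "B \<subseteq> underS r a"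
    proof
      fix b assume b: "b \<in> B"
      then have "(a, b) \<notin> r" "a \<noteq> b"
        using a(1) B(1) by (auto simp: \<B>_def under_def)
      then show "b \<in> underS r a"
        using total[of a b] a(1) b \<B>_A[OF B(1)] by (auto simp: underS_def)
    qed
    moreover have "underS r a \<subseteq> B"
      using a(2) dom by (auto simp: underS_def)
    moreover have "under r a \<in> \<B>"
      using dom transD[OF trans] by (auto simp: \<B>_def under_def)
    ultimately show ?thesis using a(1) by blast
  qed
  show ?thesis
  proof (rule orth_filtration[OF X, of "V ` \<B>"])
    show "submodule N R X" if "N \<in> V ` \<B>" for N
      using that sub \<B>_A by blast
    have "{} \<in> \<B>" by (simp add: \<B>_def)
    then show "{\<zero>\<^bsub>X\<^esub>} \<in> V ` \<B>" using V_empty by (metis imageI)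
    show "\<Union>\<D> \<in> V ` \<B>" if "\<D> \<noteq> {}" "subset.chain (V ` \<B>) \<D>" for \<D>
    proof -
      have "\<D> \<subseteq> V ` \<B>" using that(2) by (simp add: subset_chain_def)
      from V_Union[OF that(1) this, symmetric] show ?thesis
        using \<B>_Union[of "{B \<in> \<B>. V B \<in> \<D>}"] by blast
    qed
  next
    fix N assume N: "N \<in> V ` \<B>" "N \<noteq> carrier X"
    txt \<open>Taking the largest \<open>B\<close> with \<open>V B = N\<close> makes the next step of the filtration strict.\<close>
    define B where "B = \<Union>{B \<in> \<B>. V B \<in> {N}}"
    have B: "B \<in> \<B>" "V B = N"
      using \<B>_Union[of "{B \<in> \<B>. V B \<in> {N}}"] V_Union[of "{N}"] N(1) by (auto simp: B_def)
    then have "B \<noteq> A" using N(2) V_top by blast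
    then obtain a where a: "a \<in> A" "B = underS r a" "a \<notin> B" "under r a \<in> \<B>"
      using \<B>_next[OF B(1)] by blast
    have "a \<in> under r a" using refl[OF a(1)] by (simp add: under_def)
    then have "V (under r a) \<noteq> N"
      using a(3,4) by (auto simp: B_def)
    moreover have "V (underS r a) \<subseteq> V (under r a)"
      by (rule V_mono[OF _ \<B>_A[OF a(4)]]) (auto simp: under_def underS_def)
    ultimately have "N \<subset> V (under r a)"
      using a(2) B(2) by blast
    with step[OF a(1)] a(2,4) B(2) show "\<exists>N'\<in>V ` \<B>. N \<subset> N' \<and>
      (\<exists>(Q :: ('r, 'q) module) q. orth Q \<and> q \<in> mod_hom R (X\<lparr>carrier := N'\<rparr>) Q \<and>
        q ` N' = carrier Q \<and> (\<forall>x\<in>N'. q x = \<zero>\<^bsub>Q\<^esub> \<longleftrightarrow> x \<in> N))"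
      by (intro bexI[of _ "V (under r a)"]) auto
  qed
qed

end

section \<open>External direct sums\<close>

text \<open>Elements are extensional functions, so equality is decided on \<open>J\<close>; the
  operations restrict their results to \<open>J\<close> to preserve this.\<close>

definition direct_sum :: "'j set \<Rightarrow> ('j \<Rightarrow> ('r, 'a) module) \<Rightarrow> ('r, 'j \<Rightarrow> 'a) module" where
  "direct_sum J N = \<lparr>carrier = {f \<in> \<Pi>\<^sub>E j\<in>J. carrier (N j). finite {j\<in>J. f j \<noteq> \<zero>\<^bsub>N j\<^esub>}},
     monoid.mult = undefined, monoid.one = undefined,
     ring.zero = (\<lambda>j\<in>J. \<zero>\<^bsub>N j\<^esub>), ring.add = (\<lambda>f g. \<lambda>j\<in>J. f j \<oplus>\<^bsub>N j\<^esub> g j),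
     module.smult = (\<lambda>a f. \<lambda>j\<in>J. a \<odot>\<^bsub>N j\<^esub> f j)\<rparr>"

text \<open>The index set stays \<open>J\<close> and only the coordinates outside \<open>G\<close>
  vanish, so all partial sums are submodules of one module and can be compared by inclusion.\<close>

definition dsum_part :: "'j set \<Rightarrow> ('j \<Rightarrow> ('r, 'a) module) \<Rightarrow> 'j set \<Rightarrow> ('j \<Rightarrow> 'a) set" where
  "dsum_part J N G = {f \<in> carrier (direct_sum J N). \<forall>j\<in>J - G. f j = \<zero>\<^bsub>N j\<^esub>}"

definition dsum_single :: "'j set \<Rightarrow> ('j \<Rightarrow> ('r, 'a) module) \<Rightarrow> 'j \<Rightarrow> 'a \<Rightarrow> 'j \<Rightarrow> 'a" where
  "dsum_single J N i x = (\<lambda>j\<in>J. if j = i then x else \<zero>\<^bsub>N j\<^esub>)"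

locale module_family =
  fixes R :: "'r ring" and J :: "'j set" and N :: "'j \<Rightarrow> ('r, 'a) module"
  assumes family_ring: "ring R" and family_module: "j \<in> J \<Longrightarrow> left_module R (N j)"
begin

lemma dsum_simps:
  shows dsum_zero: "j \<in> J \<Longrightarrow> \<zero>\<^bsub>direct_sum J N\<^esub> j = \<zero>\<^bsub>N j\<^esub>"
    and dsum_add: "j \<in> J \<Longrightarrow> (f \<oplus>\<^bsub>direct_sum J N\<^esub> g) j = f j \<oplus>\<^bsub>N j\<^esub> g j"
    and dsum_smult: "j \<in> J \<Longrightarrow> (a \<odot>\<^bsub>direct_sum J N\<^esub> f) j = a \<odot>\<^bsub>N j\<^esub> f j"
  by (simp_all add: direct_sum_def)

lemma dsum_closed: "f \<in> carrier (direct_sum J N) \<Longrightarrow> j \<in> J \<Longrightarrow> f j \<in> carrier (N j)"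
  by (auto simp: direct_sum_def)

lemma dsum_finite_support: "f \<in> carrier (direct_sum J N) \<Longrightarrow> finite {j\<in>J. f j \<noteq> \<zero>\<^bsub>N j\<^esub>}"
  by (simp add: direct_sum_def)

lemma dsum_carrierI:
  assumes "f \<in> extensional J" "\<And>j. j \<in> J \<Longrightarrow> f j \<in> carrier (N j)" "finite {j\<in>J. f j \<noteq> \<zero>\<^bsub>N j\<^esub>}"
  shows "f \<in> carrier (direct_sum J N)"
  using assms by (auto simp: direct_sum_def PiE_iff)

lemma dsum_eqI:
  assumes "f \<in> carrier (direct_sum J N)" "g \<in> carrier (direct_sum J N)" "\<And>j. j \<in> J \<Longrightarrow> f j = g j"
  shows "f = g"
  using assms by (auto simp: direct_sum_def PiE_iff intro: extensionalityI)

lemma dsum_left_module: "left_module R (direct_sum J N)"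
proof -
  have ab: "abelian_group (N j)" if "j \<in> J" for j
    using family_module[OF that] by (simp add: left_module_def)
  have mon: "abelian_monoid (N j)" if "j \<in> J" for j
    using ab[OF that] by (simp add: abelian_group_def)
  have zero: "\<zero>\<^bsub>direct_sum J N\<^esub> \<in> carrier (direct_sum J N)"
    using abelian_monoid.zero_closed[OF mon] by (intro dsum_carrierI) (auto simp: direct_sum_def)
  have add: "f \<oplus>\<^bsub>direct_sum J N\<^esub> g \<in> carrier (direct_sum J N)"
    if "f \<in> carrier (direct_sum J N)" "g \<in> carrier (direct_sum J N)" for f g
  proof (rule dsum_carrierI)
    show "f \<oplus>\<^bsub>direct_sum J N\<^esub> g \<in> extensional J"
      by (simp add: direct_sum_def)
    show "(f \<oplus>\<^bsub>direct_sum J N\<^esub> g) j \<in> carrier (N j)" if "j \<in> J" for j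
      using that \<open>f \<in> _\<close> \<open>g \<in> _\<close> mon by (simp add: dsum_add dsum_closed abelian_monoid.a_closed)
    have "{j\<in>J. (f \<oplus>\<^bsub>direct_sum J N\<^esub> g) j \<noteq> \<zero>\<^bsub>N j\<^esub>} \<subseteq> {j\<in>J. f j \<noteq> \<zero>\<^bsub>N j\<^esub>} \<union> {j\<in>J. g j \<noteq> \<zero>\<^bsub>N j\<^esub>}"
      using mon by (auto simp: dsum_add abelian_monoid.l_zero abelian_monoid.zero_closed)
    then show "finite {j\<in>J. (f \<oplus>\<^bsub>direct_sum J N\<^esub> g) j \<noteq> \<zero>\<^bsub>N j\<^esub>}"
      by (rule finite_subset) (use that in \<open>simp add: dsum_finite_support\<close>)
  qed
  have smult: "a \<odot>\<^bsub>direct_sum J N\<^esub> f \<in> carrier (direct_sum J N)"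
    if "a \<in> carrier R" "f \<in> carrier (direct_sum J N)" for a f
  proof (rule dsum_carrierI)
    show "a \<odot>\<^bsub>direct_sum J N\<^esub> f \<in> extensional J"
      by (simp add: direct_sum_def)
    show "(a \<odot>\<^bsub>direct_sum J N\<^esub> f) j \<in> carrier (N j)" if "j \<in> J" for j
      using that \<open>a \<in> _\<close> \<open>f \<in> _\<close>
      by (simp add: dsum_smult dsum_closed left_module.smult_closed[OF family_module])
    have "{j\<in>J. (a \<odot>\<^bsub>direct_sum J N\<^esub> f) j \<noteq> \<zero>\<^bsub>N j\<^esub>} \<subseteq> {j\<in>J. f j \<noteq> \<zero>\<^bsub>N j\<^esub>}"
      using that(1) by (auto simp: dsum_smult left_module.smult_zero[OF family_module])
    then show "finite {j\<in>J. (a \<odot>\<^bsub>direct_sum J N\<^esub> f) j \<noteq> \<zero>\<^bsub>N j\<^esub>}"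
      by (rule finite_subset) (use that in \<open>simp add: dsum_finite_support\<close>)
  qed
  have neg: "\<exists>g\<in>carrier (direct_sum J N). g \<oplus>\<^bsub>direct_sum J N\<^esub> f = \<zero>\<^bsub>direct_sum J N\<^esub>" if f: "f \<in> carrier (direct_sum J N)" for f
  proof
    let ?g = "(\<ominus>\<^bsub>R\<^esub> \<one>\<^bsub>R\<^esub>) \<odot>\<^bsub>direct_sum J N\<^esub> f"
    interpret R: ring R by (rule family_ring)
    show g: "?g \<in> carrier (direct_sum J N)"
      using f by (intro smult) auto
    show "?g \<oplus>\<^bsub>direct_sum J N\<^esub> f = \<zero>\<^bsub>direct_sum J N\<^esub>"
    proof (rule dsum_eqI[OF add[OF g f] zero])
      fix j assume "j \<in> J"
      then show "(?g \<oplus>\<^bsub>direct_sum J N\<^esub> f) j = \<zero>\<^bsub>direct_sum J N\<^esub> j"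
        using f by (simp add: dsum_simps dsum_closed left_module.smult_minus_one[OF family_module]
            abelian_group.l_neg[OF ab])
    qed
  qed
  show ?thesis
  proof (rule left_moduleI[OF family_ring add zero])
    interpret R: ring R by (rule family_ring)
    show "f \<oplus>\<^bsub>direct_sum J N\<^esub> g \<oplus>\<^bsub>direct_sum J N\<^esub> h = f \<oplus>\<^bsub>direct_sum J N\<^esub> (g \<oplus>\<^bsub>direct_sum J N\<^esub> h)"
      if "f \<in> carrier (direct_sum J N)" "g \<in> carrier (direct_sum J N)" "h \<in> carrier (direct_sum J N)" for f g h
      using that by (intro dsum_eqI add) (simp_all add: dsum_simps dsum_closed abelian_monoid.a_assoc[OF mon])
    show "f \<oplus>\<^bsub>direct_sum J N\<^esub> g = g \<oplus>\<^bsub>direct_sum J N\<^esub> f"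
      if "f \<in> carrier (direct_sum J N)" "g \<in> carrier (direct_sum J N)" for f g
      using that by (intro dsum_eqI add) (simp_all add: dsum_simps dsum_closed abelian_monoid.a_comm[OF mon])
    show "\<zero>\<^bsub>direct_sum J N\<^esub> \<oplus>\<^bsub>direct_sum J N\<^esub> f = f"
      if "f \<in> carrier (direct_sum J N)" for f
      using that by (intro dsum_eqI add zero) (simp_all add: dsum_simps dsum_closed abelian_monoid.l_zero[OF mon])
    show "(a \<oplus>\<^bsub>R\<^esub> b) \<odot>\<^bsub>direct_sum J N\<^esub> f = a \<odot>\<^bsub>direct_sum J N\<^esub> f \<oplus>\<^bsub>direct_sum J N\<^esub> b \<odot>\<^bsub>direct_sum J N\<^esub> f"
      if "f \<in> carrier (direct_sum J N)" "a \<in> carrier R" "b \<in> carrier R" for f a b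
      using that by (intro dsum_eqI add smult R.a_closed)
        (simp_all add: dsum_simps dsum_closed left_module.smult_l_distr[OF family_module])
    show "a \<odot>\<^bsub>direct_sum J N\<^esub> (f \<oplus>\<^bsub>direct_sum J N\<^esub> g) = a \<odot>\<^bsub>direct_sum J N\<^esub> f \<oplus>\<^bsub>direct_sum J N\<^esub> a \<odot>\<^bsub>direct_sum J N\<^esub> g"
      if "f \<in> carrier (direct_sum J N)" "g \<in> carrier (direct_sum J N)" "a \<in> carrier R" for f g a
      using that by (intro dsum_eqI add smult)
        (simp_all add: dsum_simps dsum_closed left_module.smult_r_distr[OF family_module])
    show "(a \<otimes>\<^bsub>R\<^esub> b) \<odot>\<^bsub>direct_sum J N\<^esub> f = a \<odot>\<^bsub>direct_sum J N\<^esub> (b \<odot>\<^bsub>direct_sum J N\<^esub> f)"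
      if "f \<in> carrier (direct_sum J N)" "a \<in> carrier R" "b \<in> carrier R" for f a b
      using that by (intro dsum_eqI smult R.m_closed)
        (simp_all add: dsum_simps dsum_closed left_module.smult_assoc[OF family_module])
    show "\<one>\<^bsub>R\<^esub> \<odot>\<^bsub>direct_sum J N\<^esub> f = f"
      if "f \<in> carrier (direct_sum J N)" for f
      using that by (intro dsum_eqI smult R.one_closed)
        (simp_all add: dsum_simps dsum_closed left_module.smult_one[OF family_module])
  qed (use neg smult in auto)
qed

lemma dsum_part_subset: "dsum_part J N G \<subseteq> carrier (direct_sum J N)"
  by (auto simp: dsum_part_def)

lemma dsum_part_mono: "G \<subseteq> H \<Longrightarrow> dsum_part J N G \<subseteq> dsum_part J N H"
  by (auto simp: dsum_part_def)

lemma dsum_part_submodule: "submodule (dsum_part J N G) R (direct_sum J N)"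
proof -
  interpret D: left_module R "direct_sum J N" by (rule dsum_left_module)
  show ?thesis
  proof (rule D.submoduleI)
    show "dsum_part J N G \<subseteq> carrier (direct_sum J N)"
      by (rule dsum_part_subset)
    show "\<zero>\<^bsub>direct_sum J N\<^esub> \<in> dsum_part J N G"
      by (auto simp: dsum_part_def dsum_zero)
    show "f \<oplus>\<^bsub>direct_sum J N\<^esub> g \<in> dsum_part J N G" if "f \<in> dsum_part J N G" "g \<in> dsum_part J N G" for f g
    proof -
      have "\<zero>\<^bsub>N j\<^esub> \<oplus>\<^bsub>N j\<^esub> \<zero>\<^bsub>N j\<^esub> = \<zero>\<^bsub>N j\<^esub>" if "j \<in> J" for j
      proof -
        interpret N: left_module R "N j" using that by (rule family_module)
        show ?thesis by simp
      qed
      then show ?thesis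
        using that by (auto simp: dsum_part_def dsum_add)
    qed
    show "a \<odot>\<^bsub>direct_sum J N\<^esub> f \<in> dsum_part J N G" if "a \<in> carrier R" "f \<in> dsum_part J N G" for a f
      using that
      by (auto simp: dsum_part_def dsum_smult D.smult_closed left_module.smult_zero[OF family_module])
  qed
qed

lemma dsum_part_empty: "dsum_part J N {} = {\<zero>\<^bsub>direct_sum J N\<^esub>}"
proof -
  interpret D: left_module R "direct_sum J N" by (rule dsum_left_module)
  show ?thesis
    by (auto simp: dsum_part_def dsum_zero intro!: dsum_eqI)
qed

lemma dsum_part_finitary:
  assumes "f \<in> dsum_part J N G"
  shows "\<exists>F\<in>Fpow G. f \<in> dsum_part J N F"
  using assms dsum_finite_support[of f]
  by (intro bexI[of _ "{j\<in>J. f j \<noteq> \<zero>\<^bsub>N j\<^esub>}"]) (auto simp: dsum_part_def Fpow_def)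

lemma dsum_component_hom: "j \<in> J \<Longrightarrow> (\<lambda>f. f j) \<in> mod_hom R (direct_sum J N) (N j)"
  by (rule mod_homI) (simp_all add: dsum_simps dsum_closed)

lemma dsum_single_part:
  assumes "i \<in> J" "x \<in> carrier (N i)"
  shows "dsum_single J N i x \<in> dsum_part J N {i}"
proof -
  have "\<zero>\<^bsub>N j\<^esub> \<in> carrier (N j)" if "j \<in> J" for j
  proof -
    interpret N: left_module R "N j" using that by (rule family_module)
    show ?thesis by simp
  qed
  moreover have "finite {j\<in>J. dsum_single J N i x j \<noteq> \<zero>\<^bsub>N j\<^esub>}"
    by (rule finite_subset[of _ "{i}"]) (auto simp: dsum_single_def)
  ultimately show ?thesis
    using assms by (auto simp: dsum_part_def dsum_single_def intro!: dsum_carrierI)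
qed

lemma dsum_single_closed:
  assumes "i \<in> J" "x \<in> carrier (N i)"
  shows "dsum_single J N i x \<in> carrier (direct_sum J N)"
  using dsum_single_part[OF assms] dsum_part_subset by blast

lemma dsum_single_hom:
  assumes "i \<in> J"
  shows "dsum_single J N i \<in> mod_hom R (N i) (direct_sum J N)"
proof -
  interpret D: left_module R "direct_sum J N" by (rule dsum_left_module)
  interpret Ni: left_module R "N i" using assms by (rule family_module)
  have zero: "\<zero>\<^bsub>N j\<^esub> = \<zero>\<^bsub>N j\<^esub> \<oplus>\<^bsub>N j\<^esub> \<zero>\<^bsub>N j\<^esub>" if "j \<in> J" for j
  proof -
    interpret N: left_module R "N j" using that by (rule family_module)
    show ?thesis by simp
  qed
  show ?thesis
  proof (rule mod_homI)
    fix x y assume "x \<in> carrier (N i)" "y \<in> carrier (N i)"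
    then show "dsum_single J N i (x \<oplus>\<^bsub>N i\<^esub> y) = dsum_single J N i x \<oplus>\<^bsub>direct_sum J N\<^esub> dsum_single J N i y"
      using assms zero
      by (intro dsum_eqI) (auto simp: dsum_single_closed dsum_add, auto simp: dsum_single_def)
  next
    fix a x assume "a \<in> carrier R" "x \<in> carrier (N i)"
    then show "dsum_single J N i (a \<odot>\<^bsub>N i\<^esub> x) = a \<odot>\<^bsub>direct_sum J N\<^esub> dsum_single J N i x"
      using assms
      by (intro dsum_eqI) (auto simp: dsum_single_closed D.smult_closed Ni.smult_closed dsum_smult,
          auto simp: dsum_single_def left_module.smult_zero[OF family_module])
  qed (simp add: assms dsum_single_closed)
qed

end

text \<open>Finite support makes an element recoverable from the finite graph of its nonzero values,
  and the finite subsets of \<open>J \<times> U\<close> are of small size.\<close>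

lemma (in smallness) dsum_of_small_size:
  fixes N :: "'j \<Rightarrow> ('r, 'u) module"
  assumes "of_small_size small J" "\<And>j. j \<in> J \<Longrightarrow> small (carrier (N j))"
  shows "of_small_size small (carrier (direct_sum J N))"
proof -
  define U where "U = (\<Union>j\<in>J. carrier (N j))"
  have "of_small_size small U"
    using small_UN[OF assms] by (simp add: U_def of_small_size_iff_small)
  then have size: "of_small_size small (Fpow (J \<times> U))"
    by (intro of_small_size_Fpow of_small_size_Times assms(1))
  define graph where "graph f = {(j, f j) | j. j \<in> J \<and> f j \<noteq> \<zero>\<^bsub>N j\<^esub>}" for f
  have "inj_on graph (carrier (direct_sum J N))"
  proof (rule inj_onI)
    fix f g assume fg: "f \<in> carrier (direct_sum J N)" "g \<in> carrier (direct_sum J N)" "graph f = graph g"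
    have "f j = g j" if "j \<in> J" for j
    proof (cases "f j = \<zero>\<^bsub>N j\<^esub>")
      case True
      then have "(j, g j) \<notin> graph f" by (auto simp: graph_def)
      then show ?thesis
        using True that fg(3) by (auto simp: graph_def)
    next
      case False
      then have "(j, f j) \<in> graph g" using that fg(3) by (auto simp: graph_def)
      then show ?thesis by (auto simp: graph_def)
    qed
    with fg show "f = g"
      by (auto simp: direct_sum_def PiE_iff intro: extensionalityI)
  qed
  moreover have "graph ` carrier (direct_sum J N) \<subseteq> Fpow (J \<times> U)"
  proof (rule image_subsetI)
    fix f assume f: "f \<in> carrier (direct_sum J N)"
    have "graph f = (\<lambda>j. (j, f j)) ` {j\<in>J. f j \<noteq> \<zero>\<^bsub>N j\<^esub>}"
      by (auto simp: graph_def)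
    then show "graph f \<in> Fpow (J \<times> U)"
      using f by (auto simp: direct_sum_def Fpow_def U_def PiE_iff)
  qed
  ultimately have "carrier (direct_sum J N) \<lesssim> Fpow (J \<times> U)"
    unfolding lepoll_def by blast
  with size show ?thesis by (rule of_small_size_lepoll)
qed

text \<open>Any well-order of \<open>G\<close> filters the sum by partial sums, and evaluation at
  \<open>a\<close> identifies the successive quotient at \<open>a\<close> with
  \<open>N a\<close>.\<close>

lemma (in thick_cotorsion_pair) orth_dsum_part:
  fixes N :: "'j \<Rightarrow> ('r, 'u) module"
  assumes "ring R" and J: "of_small_size small J" and N: "\<And>j. j \<in> J \<Longrightarrow> N j \<in> \<W>" and G: "G \<subseteq> J"
  shows "orth (direct_sum J N\<lparr>carrier := dsum_part J N G\<rparr>)"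
proof -
  have RMod: "N j \<in> RMod small R" if "j \<in> J" for j
    using N that left_class_RMod by blast
  interpret F: module_family R J N
    using assms(1) RMod by (intro module_family.intro) (auto simp: RMod_def)
  interpret D: left_module R "direct_sum J N" by (rule F.dsum_left_module)
  let ?V = "dsum_part J N"
  let ?X = "direct_sum J N\<lparr>carrier := ?V G\<rparr>"
  have X: "left_module R ?X"
    by (rule D.submodule_left_module[OF F.dsum_part_submodule])
  have "of_small_size small (carrier (direct_sum J N))"
    using RMod by (intro dsum_of_small_size J) (auto simp: RMod_def)
  then have size: "of_small_size small (carrier ?X)"
    using of_small_size_subset[OF _ F.dsum_part_subset] by simp
  obtain r where r: "well_order_on G r"
    using well_order_on by blast
  show ?thesis
  proof (rule orth_transfinite_extension[OF X size r, of ?V])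
    show "submodule (?V B) R ?X" if "B \<subseteq> G" for B
      using that by (intro D.submodule_restrict F.dsum_part_submodule F.dsum_part_mono)
    show "?V {} = {\<zero>\<^bsub>?X\<^esub>}" "?V G = carrier ?X"
      by (simp_all add: F.dsum_part_empty)
    show "?V B \<subseteq> ?V B'" if "B \<subseteq> B'" for B B'
      using that by (rule F.dsum_part_mono)
    show "\<exists>F\<in>Fpow B. x \<in> ?V F" if "x \<in> ?V B" for B x
      using that by (rule F.dsum_part_finitary)
  next
    fix a assume a: "a \<in> G"
    then have aJ: "a \<in> J" using G by blast
    have "(a, a) \<in> r"
      using r a by (auto simp: well_order_on_def linear_order_on_def partial_order_on_def
          preorder_on_def refl_on_def)
    then have under: "under r a = insert a (underS r a)" "a \<notin> underS r a"
      by (auto simp: under_def underS_def)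
    have "(\<lambda>f. f a) \<in> mod_hom R (direct_sum J N\<lparr>carrier := ?V (under r a)\<rparr>) (N a)"
      by (rule mod_hom_restrict_dom[OF F.dsum_component_hom[OF aJ] F.dsum_part_subset])
    moreover have "(\<lambda>f. f a) ` ?V (under r a) = carrier (N a)"
    proof
      show "carrier (N a) \<subseteq> (\<lambda>f. f a) ` ?V (under r a)"
      proof
        fix x assume "x \<in> carrier (N a)"
        then have "dsum_single J N a x \<in> ?V (under r a)"
          using F.dsum_single_part[OF aJ] F.dsum_part_mono[of "{a}" "under r a"] under by blast
        moreover have "x = dsum_single J N a x a"
          using aJ by (simp add: dsum_single_def)
        ultimately show "x \<in> (\<lambda>f. f a) ` ?V (under r a)" by blast
      qed
    qed (use aJ F.dsum_closed F.dsum_part_subset in blast)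
    moreover have "f a = \<zero>\<^bsub>N a\<^esub> \<longleftrightarrow> f \<in> ?V (underS r a)" if "f \<in> ?V (under r a)" for f
      using that aJ under by (auto simp: dsum_part_def)
    ultimately show "\<exists>(Q :: ('r, 'u) module) q. orth Q \<and>
      q \<in> mod_hom R (?X\<lparr>carrier := ?V (under r a)\<rparr>) Q \<and> q ` ?V (under r a) = carrier Q \<and>
      (\<forall>x\<in>?V (under r a). q x = \<zero>\<^bsub>Q\<^esub> \<longleftrightarrow> x \<in> ?V (underS r a))"
      using orth_iff[OF RMod[OF aJ]] N[OF aJ]
      by (intro exI[of _ "N a"] exI[of _ "\<lambda>f. f a"]) auto
  qed
qed

section \<open>Direct limits over the finite subsets of a set\<close>

lemma mod_hom_finsum:
  assumes "left_module R M" "left_module R N" "f \<in> mod_hom R M N" "finite A" "g \<in> A \<rightarrow> carrier M"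
  shows "f (finsum M g A) = finsum N (\<lambda>x. f (g x)) A"
  using assms(4,5)
proof (induction A rule: finite_induct)
  case empty
  interpret M: left_module R M by fact
  interpret N: left_module R N by fact
  show ?case using mod_hom_zero[OF assms(1-3)] by simp
next
  case (insert a A)
  interpret M: left_module R M by fact
  interpret N: left_module R N by fact
  have "(\<lambda>x. f (g x)) \<in> A \<rightarrow> carrier N" "f (g a) \<in> carrier N"
    using insert.prems mod_hom_closed[OF assms(3)] by auto
  then show ?case
    using insert by (simp add: mod_hom_add[OF assms(3)] Pi_iff)
qed

lemma (in left_module) finsum_smult:
  assumes "a \<in> carrier R" "finite A" "g \<in> A \<rightarrow> carrier M"
  shows "a \<odot>\<^bsub>M\<^esub> finsum M g A = finsum M (\<lambda>x. a \<odot>\<^bsub>M\<^esub> g x) A"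
  using assms(2,3)
proof (induction A rule: finite_induct)
  case empty
  show ?case using assms(1) by (simp add: smult_zero)
next
  case (insert x A)
  have "(\<lambda>x. a \<odot>\<^bsub>M\<^esub> g x) \<in> A \<rightarrow> carrier M" "a \<odot>\<^bsub>M\<^esub> g x \<in> carrier M"
    using insert.prems assms(1) smult_closed by auto
  then show ?case
    using insert assms(1) by (simp add: smult_r_distr Pi_iff)
qed

lemma Fpow_subset: "\<lbrakk>G \<subseteq> F; F \<in> Fpow S\<rbrakk> \<Longrightarrow> G \<in> Fpow S"
  by (auto simp: Fpow_def intro: finite_subset)

lemma Fpow_Un: "\<lbrakk>F \<in> Fpow S; G \<in> Fpow S\<rbrakk> \<Longrightarrow> F \<union> G \<in> Fpow S"
  by (auto simp: Fpow_def)

text \<open>Fixing \<open>S\<close> once lets the subsystems over \<open>Fpow B\<close>, for all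
  \<open>B \<subseteq> S\<close>, be treated inside the same direct sum.\<close>

locale finite_subset_system = thick_cotorsion_pair small R \<W> \<F>
  for small :: "'u set \<Rightarrow> bool" and R :: "'r ring" and \<W> \<F> +
  fixes S :: "'i set" and N :: "'i set \<Rightarrow> ('r, 'u) module" and \<tau> :: "'i set \<Rightarrow> 'i set \<Rightarrow> 'u \<Rightarrow> 'u"
  assumes ring: "ring R" and size: "of_small_size small S"
    and N_left_class: "F \<in> Fpow S \<Longrightarrow> N F \<in> \<W>"
    and \<tau>_hom: "\<lbrakk>F \<subseteq> G; G \<in> Fpow S\<rbrakk> \<Longrightarrow> \<tau> F G \<in> mod_hom R (N F) (N G)"
    and \<tau>_id: "\<lbrakk>F \<in> Fpow S; x \<in> carrier (N F)\<rbrakk> \<Longrightarrow> \<tau> F F x = x"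
    and \<tau>_comp: "\<lbrakk>F \<subseteq> G; G \<subseteq> H; H \<in> Fpow S; x \<in> carrier (N F)\<rbrakk> \<Longrightarrow> \<tau> G H (\<tau> F G x) = \<tau> F H x"
begin

lemma N_left_module: "F \<in> Fpow S \<Longrightarrow> left_module R (N F)"
  using N_left_class left_class_RMod by (auto simp: RMod_def)

sublocale module_family R "Fpow S" N
  by (intro module_family.intro ring N_left_module)

abbreviation D :: "('r, 'i set \<Rightarrow> 'u) module" where
  "D \<equiv> direct_sum (Fpow S) N"

abbreviation part :: "'i set set \<Rightarrow> ('i set \<Rightarrow> 'u) set" where
  "part \<equiv> dsum_part (Fpow S) N"

abbreviation single :: "'i set \<Rightarrow> 'u \<Rightarrow> 'i set \<Rightarrow> 'u" where
  "single \<equiv> dsum_single (Fpow S) N"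

sublocale D: left_module R D
  by (rule dsum_left_module)

lemma D_of_small_size: "of_small_size small (carrier D)"
  using N_left_class left_class_RMod size
  by (intro dsum_of_small_size of_small_size_Fpow) (auto simp: RMod_def)

text \<open>On the part over \<open>Pow F\<close> this is the map to the direct limit:
  \<open>F\<close> is the greatest element of \<open>Pow F\<close>, so the limit is
  \<open>N F\<close>. Coordinates outside \<open>Pow F\<close> are ignored, which makes
  \<open>\<sigma> F\<close> a homomorphism on all of \<open>D\<close>.\<close>

definition \<sigma> :: "'i set \<Rightarrow> ('i set \<Rightarrow> 'u) \<Rightarrow> 'u" where
  "\<sigma> F f = finsum (N F) (\<lambda>G. \<tau> G F (f G)) (Pow F)"

lemma \<tau>_closed: "\<lbrakk>F \<subseteq> G; G \<in> Fpow S; x \<in> carrier (N F)\<rbrakk> \<Longrightarrow> \<tau> F G x \<in> carrier (N G)"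
  using \<tau>_hom mod_hom_closed by metis

lemma \<tau>_zero: "\<lbrakk>F \<subseteq> G; G \<in> Fpow S\<rbrakk> \<Longrightarrow> \<tau> F G \<zero>\<^bsub>N F\<^esub> = \<zero>\<^bsub>N G\<^esub>"
  using mod_hom_zero[OF N_left_module N_left_module \<tau>_hom] Fpow_subset by blast

lemma \<sigma>_terms:
  assumes "F \<in> Fpow S" "f \<in> carrier D"
  shows "(\<lambda>G. \<tau> G F (f G)) \<in> Pow F \<rightarrow> carrier (N F)"
proof (rule Pi_I)
  fix G assume "G \<in> Pow F"
  then show "\<tau> G F (f G) \<in> carrier (N F)"
    using \<tau>_closed[OF _ assms(1) dsum_closed[OF assms(2)]] Fpow_subset[OF _ assms(1)] by simp
qed

lemma \<sigma>_hom:
  assumes F: "F \<in> Fpow S"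
  shows "\<sigma> F \<in> mod_hom R D (N F)"
proof -
  interpret NF: left_module R "N F" using F by (rule N_left_module)
  have G: "G \<in> Fpow S" "\<tau> G F \<in> mod_hom R (N G) (N F)" if "G \<in> Pow F" for G
    using that F \<tau>_hom Fpow_subset by auto
  have fin: "finite (Pow F)" using F by (simp add: Fpow_def)
  show ?thesis
  proof (rule mod_homI)
    fix f g assume fg: "f \<in> carrier D" "g \<in> carrier D"
    have "\<sigma> F (f \<oplus>\<^bsub>D\<^esub> g) = finsum (N F) (\<lambda>G. \<tau> G F (f G) \<oplus>\<^bsub>N F\<^esub> \<tau> G F (g G)) (Pow F)"
      unfolding \<sigma>_def using fg G \<sigma>_terms[OF F]
      by (intro NF.M.finsum_cong') (auto simp: dsum_add mod_hom_add[OF G(2)] dsum_closed Pi_iff)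
    then show "\<sigma> F (f \<oplus>\<^bsub>D\<^esub> g) = \<sigma> F f \<oplus>\<^bsub>N F\<^esub> \<sigma> F g"
      using fg \<sigma>_terms[OF F] by (simp add: \<sigma>_def NF.M.finsum_addf)
  next
    fix a f assume af: "a \<in> carrier R" "f \<in> carrier D"
    have "\<sigma> F (a \<odot>\<^bsub>D\<^esub> f) = finsum (N F) (\<lambda>G. a \<odot>\<^bsub>N F\<^esub> \<tau> G F (f G)) (Pow F)"
      unfolding \<sigma>_def using af G \<sigma>_terms[OF F] NF.smult_closed
      by (intro NF.M.finsum_cong') (auto simp: dsum_smult mod_hom_smult[OF G(2)] dsum_closed Pi_iff)
    then show "\<sigma> F (a \<odot>\<^bsub>D\<^esub> f) = a \<odot>\<^bsub>N F\<^esub> \<sigma> F f"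
      using af \<sigma>_terms[OF F] fin by (simp add: \<sigma>_def NF.finsum_smult)
  qed (use \<sigma>_terms[OF F] in \<open>simp add: \<sigma>_def NF.M.finsum_closed\<close>)
qed

lemma \<sigma>_closed: "\<lbrakk>F \<in> Fpow S; f \<in> carrier D\<rbrakk> \<Longrightarrow> \<sigma> F f \<in> carrier (N F)"
  using \<sigma>_hom mod_hom_closed by metis

text \<open>Functoriality of \<open>\<tau>\<close> turns the left side into a sum over
  \<open>Pow F\<close> in \<open>N G\<close>. The remaining summands of \<open>\<sigma> G f\<close>
  vanish because \<open>f\<close> is supported in \<open>Pow F\<close>.\<close>

lemma \<tau>_\<sigma>:
  assumes FG: "F \<subseteq> G" "G \<in> Fpow S" and f: "f \<in> part (Pow F)"
  shows "\<tau> F G (\<sigma> F f) = \<sigma> G f"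
proof -
  have F: "F \<in> Fpow S" using FG by (rule Fpow_subset)
  interpret NF: left_module R "N F" using F by (rule N_left_module)
  interpret NG: left_module R "N G" using FG(2) by (rule N_left_module)
  have fD: "f \<in> carrier D" using f dsum_part_subset by blast
  have "finite (Pow G)" "finite (Pow F)" using F FG(2) by (simp_all add: Fpow_def)
  have sub: "H \<in> Fpow S" if "H \<in> Pow G" for H
    using that FG(2) Fpow_subset by blast
  have "\<tau> F G (\<sigma> F f) = finsum (N G) (\<lambda>H. \<tau> F G (\<tau> H F (f H))) (Pow F)"
    unfolding \<sigma>_def
    by (rule mod_hom_finsum[OF N_left_module[OF F] N_left_module[OF FG(2)] \<tau>_hom[OF FG]
          \<open>finite (Pow F)\<close> \<sigma>_terms[OF F fD]])
  also have "\<dots> = finsum (N G) (\<lambda>H. \<tau> H G (f H)) (Pow F)"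
  proof (rule NG.M.finsum_cong')
    fix H assume "H \<in> Pow F"
    then show "\<tau> F G (\<tau> H F (f H)) = \<tau> H G (f H)"
      using FG sub by (intro \<tau>_comp dsum_closed[OF fD]) auto
  qed (use FG \<sigma>_terms[OF FG(2) fD] in auto)
  also have "\<dots> = finsum (N G) (\<lambda>H. \<tau> H G (f H)) (Pow G)"
  proof (rule NG.M.add.finprod_mono_neutral_cong_left)
    show "\<tau> H G (f H) = \<zero>\<^bsub>N G\<^esub>" if "H \<in> Pow G - Pow F" for H
      using that f sub[of H] FG(2) by (auto simp: dsum_part_def \<tau>_zero)
  qed (use \<open>finite (Pow G)\<close> FG \<sigma>_terms[OF FG(2) fD] in auto)
  finally show ?thesis
    by (simp add: \<sigma>_def)
qed

text \<open>Only the coordinate \<open>F\<close> contributes, through the identity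
  \<open>\<tau> F F\<close>. In particular \<open>\<sigma> F\<close> maps onto
  \<open>N F\<close>.\<close>

lemma \<sigma>_single:
  assumes F: "F \<in> Fpow S" and x: "x \<in> carrier (N F)"
  shows "\<sigma> F (single F x) = x"
proof -
  interpret NF: left_module R "N F" using F by (rule N_left_module)
  have sub: "H \<in> Fpow S" if "H \<in> Pow F" for H
    using that F Fpow_subset by blast
  have "\<sigma> F (single F x) = finsum (N F) (\<lambda>H. \<tau> H F (single F x H)) {F}"
    unfolding \<sigma>_def
  proof (rule NF.M.add.finprod_mono_neutral_cong_left[symmetric])
    show "\<tau> H F (single F x H) = \<zero>\<^bsub>N F\<^esub>" if "H \<in> Pow F - {F}" for H
      using that sub[of H] F by (auto simp: dsum_single_def \<tau>_zero)
  qed (use F \<sigma>_terms[OF F dsum_single_closed[OF F x]] in \<open>auto simp: Fpow_def\<close>)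
  also have "\<dots> = x"
    using F x by (simp add: dsum_single_def \<tau>_id)
  finally show ?thesis .
qed

lemma part_Un:
  assumes "f \<in> part (Pow F)" "g \<in> part (Pow G)"
  shows "f \<in> part (Pow (F \<union> G))" "g \<in> part (Pow (F \<union> G))"
  using assms dsum_part_mono[of "Pow F" "Pow (F \<union> G)"] dsum_part_mono[of "Pow G" "Pow (F \<union> G)"]
  by blast+

text \<open>These are the relations visible at stage \<open>F\<close>. In a directed system an
  element vanishes in the limit exactly when it vanishes at some stage, so the union of the
  \<open>Z F\<close> is the full kernel.\<close>

definition Z :: "'i set \<Rightarrow> ('i set \<Rightarrow> 'u) set" where
  "Z F = {f \<in> part (Pow F). \<sigma> F f = \<zero>\<^bsub>N F\<^esub>}"

text \<open>The kernel of the map from the direct sum over \<open>Fpow B\<close> to the direct limit over \<open>Fpow B\<close>.\<close>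

definition K :: "'i set \<Rightarrow> ('i set \<Rightarrow> 'u) set" where
  "K B = (\<Union>F\<in>Fpow B. Z F)"

lemma Z_subset: "Z F \<subseteq> carrier D"
  using dsum_part_subset by (auto simp: Z_def)

lemma K_subset: "K B \<subseteq> carrier D"
  using Z_subset by (auto simp: K_def)

lemma Z_mono:
  assumes "F \<subseteq> G" "G \<in> Fpow S"
  shows "Z F \<subseteq> Z G"
proof
  fix f assume f: "f \<in> Z F"
  then have "\<sigma> G f = \<tau> F G \<zero>\<^bsub>N F\<^esub>"
    using \<tau>_\<sigma>[OF assms, of f, symmetric] by (simp add: Z_def)
  then show "f \<in> Z G"
    using f dsum_part_mono[of "Pow F" "Pow G"] assms \<tau>_zero by (auto simp: Z_def)
qed

lemma Z_submodule:
  assumes "F \<in> Fpow S"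
  shows "submodule (Z F) R D"
proof -
  have "submodule {f \<in> part (Pow F). \<sigma> F f = \<zero>\<^bsub>N F\<^esub>} R (D\<lparr>carrier := part (Pow F)\<rparr>)"
    using submodule_kernel[OF D.submodule_left_module[OF dsum_part_submodule] N_left_module[OF assms]
        mod_hom_restrict_dom[OF \<sigma>_hom[OF assms] dsum_part_subset]]
    by simp
  then show ?thesis
    using D.submodule_trans[OF dsum_part_submodule] by (simp add: Z_def)
qed

lemma K_mono: "B \<subseteq> B' \<Longrightarrow> K B \<subseteq> K B'"
  by (auto simp: K_def Fpow_def)

text \<open>\<open>F\<close> is the greatest member of \<open>Fpow F\<close> and \<open>Z\<close> is
  monotone, so the union is attained at \<open>F\<close>.\<close>

lemma K_finite:
  assumes "F \<in> Fpow S" shows "K F = Z F"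
  using Z_mono[OF _ assms] assms by (auto simp: K_def Fpow_def)

lemma K_submodule:
  assumes "B \<subseteq> S"
  shows "submodule (K B) R D"
proof (rule D.submoduleI)
  have Fpow: "F \<in> Fpow S" if "F \<in> Fpow B" for F
    using that assms by (auto simp: Fpow_def)
  show "K B \<subseteq> carrier D" by (rule K_subset)
  have "\<zero>\<^bsub>D\<^esub> \<in> Z {}"
    by (rule D.submodule_zero[OF Z_submodule]) (simp add: Fpow_def)
  then show "\<zero>\<^bsub>D\<^esub> \<in> K B"
    by (auto simp: K_def Fpow_def)
  show "f \<oplus>\<^bsub>D\<^esub> g \<in> K B" if fg: "f \<in> K B" "g \<in> K B" for f g
  proof -
    obtain F G where F: "F \<in> Fpow B" "f \<in> Z F" and G: "G \<in> Fpow B" "g \<in> Z G"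
      using fg by (auto simp: K_def)
    then have FG: "F \<union> G \<in> Fpow B" by (auto simp: Fpow_def)
    then have "f \<in> Z (F \<union> G)" "g \<in> Z (F \<union> G)"
      using F G Z_mono[of F "F \<union> G"] Z_mono[of G "F \<union> G"] Fpow[OF FG] by blast+
    then have "f \<oplus>\<^bsub>D\<^esub> g \<in> Z (F \<union> G)"
      using D.submodule_add[OF Z_submodule[OF Fpow[OF FG]]] by blast
    then show ?thesis
      using FG by (auto simp: K_def)
  qed
  show "a \<odot>\<^bsub>D\<^esub> f \<in> K B" if "a \<in> carrier R" "f \<in> K B" for a f
    using that D.submodule_smult[OF Z_submodule] Fpow unfolding K_def by blast
qed

text \<open>\<open>Pow {}\<close> has a single member and \<open>\<sigma> {}\<close> is the identity
  on its coordinate. The filtration of the kernels therefore starts at zero.\<close>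

lemma K_empty: "K {} = {\<zero>\<^bsub>D\<^esub>}"
proof
  have e: "{} \<in> Fpow S" by (simp add: Fpow_def)
  interpret Ne: left_module R "N {}" using e by (rule N_left_module)
  show "K {} \<subseteq> {\<zero>\<^bsub>D\<^esub>}"
  proof
    fix f assume "f \<in> K {}"
    then have f: "f \<in> part {{}}" "\<sigma> {} f = \<zero>\<^bsub>N {}\<^esub>"
      by (auto simp: K_finite[OF e] Z_def)
    then have fD: "f \<in> carrier D" using dsum_part_subset by blast
    have "f {} \<in> carrier (N {})"
      using e fD by (simp add: dsum_closed)
    then have "f {} = \<zero>\<^bsub>N {}\<^esub>"
      using f(2) e by (simp add: \<sigma>_def \<tau>_id)
    then have "f = \<zero>\<^bsub>D\<^esub>"
      using f(1) fD by (intro dsum_eqI) (auto simp: dsum_zero dsum_part_def)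
    then show "f \<in> {\<zero>\<^bsub>D\<^esub>}" by simp
  qed
  show "{\<zero>\<^bsub>D\<^esub>} \<subseteq> K {}"
    using D.submodule_zero[OF K_submodule[of "{}"]] by simp
qed

text \<open>Thickness is used here for the kernel of a surjection, namely of
  \<open>\<sigma> F\<close> from the direct sum over the subsets of \<open>F\<close> onto
  \<open>N F\<close>.\<close>

lemma orth_K_finite:
  assumes F: "F \<in> Fpow S"
  shows "orth (D\<lparr>carrier := K F\<rparr>)"
proof -
  let ?P = "D\<lparr>carrier := part (Pow F)\<rparr>"
  have "Pow F \<subseteq> Fpow S"
    using F by (auto simp: Fpow_def intro: finite_subset)
  then have P: "orth ?P"
    using ring N_left_class by (intro orth_dsum_part of_small_size_Fpow size)
  have NF: "orth (N F)"
    using orth_iff N_left_class[OF F] left_class_RMod by blast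
  have "\<sigma> F ` carrier ?P = carrier (N F)"
  proof
    show "\<sigma> F ` carrier ?P \<subseteq> carrier (N F)"
      using \<sigma>_closed[OF F] dsum_part_subset by auto
    show "carrier (N F) \<subseteq> \<sigma> F ` carrier ?P"
    proof
      fix x assume x: "x \<in> carrier (N F)"
      then have "single F x \<in> carrier ?P"
        using dsum_single_part[OF F x] dsum_part_mono[of "{F}" "Pow F"] by auto
      then show "x \<in> \<sigma> F ` carrier ?P"
        using \<sigma>_single[OF F x] by (metis imageI)
    qed
  qed
  then have "short_exact R (?P\<lparr>carrier := {f \<in> carrier ?P. \<sigma> F f = \<zero>\<^bsub>N F\<^esub>}\<rparr>) (\<lambda>x. x) ?P (\<sigma> F) (N F)"
    by (intro short_exact_submodule orthD(1)[OF P] orthD(1)[OF NF]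
        mod_hom_restrict_dom[OF \<sigma>_hom[OF F] dsum_part_subset])
  then have "short_exact R (D\<lparr>carrier := K F\<rparr>) (\<lambda>x. x) ?P (\<sigma> F) (N F)"
    by (simp add: K_finite[OF F] Z_def)
  moreover have "left_module R (D\<lparr>carrier := K F\<rparr>)"
    using F by (intro D.submodule_left_module K_submodule) (simp add: Fpow_def)
  moreover have "of_small_size small (carrier (D\<lparr>carrier := K F\<rparr>))"
    using of_small_size_subset[OF D_of_small_size K_subset] by simp
  ultimately show ?thesis
    by (intro orth_thick(3)[OF _ _ orthD[OF P] orthD[OF NF] _ P NF])
qed

lemma orth_K: "B \<subseteq> S \<Longrightarrow> orth (D\<lparr>carrier := K B\<rparr>)"
proof (induction B rule: wf_induct_rule[OF wf_inv_image[OF wf_ordLess, of card_of]])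
  case (1 B)
  have IH: "orth (D\<lparr>carrier := K C\<rparr>)" if "(card_of C, card_of B) \<in> ordLess" "C \<subseteq> B" for C
    using 1(1)[of C] 1(2) that by (auto simp: in_inv_image)
  show ?case
  proof (cases "finite B")
    case True
    then show ?thesis using 1(2) by (intro orth_K_finite) (simp add: Fpow_def)
  next
    case False
    \<comment> \<open>A well-order of \<open>B\<close> of cardinal type: every
      \<open>underS r a\<close> has smaller cardinality than \<open>B\<close>, so the induction
      hypothesis covers it.\<close>
    define r where "r = card_of B"
    have r: "well_order_on B r" "Card_order r" "Field r = B"
      using card_of_well_order_on[of B] card_of_Card_order[of B] Field_card_of[of B]
      by (simp_all only: r_def)
    then have tr: "trans r" "antisym r"
      by (auto simp: well_order_on_def linear_order_on_def partial_order_on_def preorder_on_def)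
    have sub: "underS r a \<subseteq> B" "under r a \<subseteq> B" for a
      using well_order_on_domain[OF r(1)] by (auto simp: under_def underS_def)
    have underS: "(card_of (underS r a), card_of B) \<in> ordLess" if "a \<in> B" for a
      using card_of_underS[OF r(2)] that r(3) by (simp add: r_def)
    \<comment> \<open>Closed segments are covered too. An infinite cardinal has no greatest element,
      so \<open>under r a\<close> lies inside \<open>underS r b\<close> for some \<open>b\<close>
      above \<open>a\<close>.\<close>
    have under: "(card_of (under r a), card_of B) \<in> ordLess" if a: "a \<in> B" for a
    proof -
      obtain b where b: "b \<in> B" "a \<noteq> b" "(a, b) \<in> r"
        using infinite_Card_order_limit[OF r(2)] False a r(3) by metis
      then have "under r a \<subseteq> underS r b"
        using transD[OF tr(1)] antisymD[OF tr(2)] by (auto simp: under_def underS_def)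
      then show ?thesis
        using ordLeq_ordLess_trans[OF card_of_mono1 underS[OF b(1)]] by blast
    qed
    show ?thesis
    proof (rule orth_transfinite_extension[OF _ _ r(1), of _ K])
      show "left_module R (D\<lparr>carrier := K B\<rparr>)"
        by (rule D.submodule_left_module[OF K_submodule[OF 1(2)]])
      show "of_small_size small (carrier (D\<lparr>carrier := K B\<rparr>))"
        using of_small_size_subset[OF D_of_small_size K_subset] by simp
      show "submodule (K C) R (D\<lparr>carrier := K B\<rparr>)" if "C \<subseteq> B" for C
        using that 1(2) by (intro D.submodule_restrict K_submodule K_mono) auto
      show "\<exists>F\<in>Fpow C. x \<in> K F" if "C \<subseteq> B" "x \<in> K C" for C x
        using that by (auto simp: K_def Fpow_def)
      show "K C \<subseteq> K C'" if "C \<subseteq> C'" for C C'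
        using that by (rule K_mono)
    next
      fix a assume a: "a \<in> B"
      have "underS r a \<subseteq> under r a" by (auto simp: under_def underS_def)
      then have "submodule (K (underS r a)) R (D\<lparr>carrier := K (under r a)\<rparr>)"
        using sub 1(2) by (intro D.submodule_restrict K_submodule K_mono) blast+
      then obtain Q :: "('r, 'i set \<Rightarrow> 'u) module" and q where
        "orth Q" "q \<in> mod_hom R (D\<lparr>carrier := K (under r a)\<rparr>) Q" "carrier Q = q ` K (under r a)"
        "\<And>x. x \<in> K (under r a) \<Longrightarrow> q x = \<zero>\<^bsub>Q\<^esub> \<longleftrightarrow> x \<in> K (underS r a)"
        using orth_quotient[OF IH[OF under[OF a] sub(2)], of "K (underS r a)"]
          IH[OF underS[OF a] sub(1)]
        by auto
      then show "\<exists>(Q :: ('r, 'i set \<Rightarrow> 'u) module) q. orth Q \<and>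
        q \<in> mod_hom R (D\<lparr>carrier := K B, carrier := K (under r a)\<rparr>) Q \<and>
        q ` K (under r a) = carrier Q \<and>
        (\<forall>x\<in>K (under r a). q x = \<zero>\<^bsub>Q\<^esub> \<longleftrightarrow> x \<in> K (underS r a))"
        by (intro exI[of _ Q] exI[of _ q]) simp
    qed (simp_all add: K_empty)
  qed
qed

text \<open>The least \<open>F\<close> such that \<open>f\<close> is supported in
  \<open>Pow F\<close>; it is finite for \<open>f\<close> in \<open>D\<close>, whose support is a
  finite set of finite sets. It serves as a canonical stage at which to evaluate
  \<open>f\<close>.\<close>

definition \<upsilon> :: "('i set \<Rightarrow> 'u) \<Rightarrow> 'i set" where
  "\<upsilon> f = \<Union>{F \<in> Fpow S. f F \<noteq> \<zero>\<^bsub>N F\<^esub>}"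

lemma \<upsilon>:
  assumes "f \<in> carrier D"
  shows "\<upsilon> f \<in> Fpow S" "f \<in> part (Pow (\<upsilon> f))"
  using assms dsum_finite_support[OF assms] by (auto simp: \<upsilon>_def Fpow_def dsum_part_def)

lemma \<upsilon>_least:
  assumes "f \<in> part (Pow F)"
  shows "\<upsilon> f \<subseteq> F"
  using assms by (auto simp: \<upsilon>_def dsum_part_def)

text \<open>Unlike in \<open>cocone\<close>, the element type of \<open>X\<close> is free here,
  because the limit constructed below consists of functions.\<close>

definition is_cocone :: "('r, 'a) module \<Rightarrow> ('i set \<Rightarrow> 'u \<Rightarrow> 'a) \<Rightarrow> bool" where
  "is_cocone X c \<longleftrightarrow> (\<forall>F\<in>Fpow S. c F \<in> mod_hom R (N F) X) \<and>
     (\<forall>G\<in>Fpow S. \<forall>F. F \<subseteq> G \<longrightarrow> (\<forall>x\<in>carrier (N F). c G (\<tau> F G x) = c F x))"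

lemma is_coconeD:
  assumes "is_cocone X c"
  shows "F \<in> Fpow S \<Longrightarrow> c F \<in> mod_hom R (N F) X"
    and "\<lbrakk>F \<subseteq> G; G \<in> Fpow S; x \<in> carrier (N F)\<rbrakk> \<Longrightarrow> c G (\<tau> F G x) = c F x"
  using assms by (auto simp: is_cocone_def)

text \<open>\<open>Q\<close> is the direct sum modulo \<open>K S\<close>. The universal property
  asserts existence only; uniqueness is accounted for by the images of the \<open>q F\<close>, which
  cover \<open>Q\<close>.\<close>

theorem ex_orth_direct_limit:
  obtains Q :: "('r, 'i set \<Rightarrow> 'u) module" and q
  where "orth Q" "is_cocone Q q" "carrier Q = (\<Union>F\<in>Fpow S. q F ` carrier (N F))"
    "\<forall>(X :: ('r, 'u) module) c. left_module R X \<and> is_cocone X c \<longrightarrow>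
      (\<exists>k\<in>mod_hom R Q X. \<forall>F\<in>Fpow S. \<forall>x\<in>carrier (N F). k (q F x) = c F x)"
proof -
  have "D\<lparr>carrier := part (Fpow S)\<rparr> = D"
    by (auto simp: dsum_part_def direct_sum_def)
  then have "orth D"
    using orth_dsum_part[where N = N, OF ring of_small_size_Fpow[OF size] N_left_class subset_refl]
    by simp
  then obtain Q :: "('r, 'i set \<Rightarrow> 'u) module" and p where Q: "orth Q"
    and p: "p \<in> mod_hom R D Q" "carrier Q = p ` carrier D"
    and ker: "\<And>f. f \<in> carrier D \<Longrightarrow> p f = \<zero>\<^bsub>Q\<^esub> \<longleftrightarrow> f \<in> K S"
    using orth_quotient[OF _ K_submodule orth_K] by blast
  note modQ = orthD(1)[OF Q]
  define q where "q F = p \<circ> single F" for F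
  \<comment> \<open>Elements supported in \<open>Pow F\<close> with the same value at stage
    \<open>F\<close> differ by a member of \<open>K S\<close>, hence agree in \<open>Q\<close>. The
    cocone identities and the covering of \<open>Q\<close> are both instances of this.\<close>
  have p_eqI: "p f = p g" if "f \<in> carrier D" "g \<in> carrier D" "f \<in> part (Pow F)" "g \<in> part (Pow F)"
    "\<sigma> F f = \<sigma> F g" "F \<in> Fpow S" for f g F
  proof -
    have "f \<ominus>\<^bsub>D\<^esub> g \<in> part (Pow F)"
      using that by (intro D.submodule_minus[OF dsum_part_submodule])
    moreover have "\<sigma> F (f \<ominus>\<^bsub>D\<^esub> g) = \<zero>\<^bsub>N F\<^esub>"
      using mod_hom_eq_iff[OF dsum_left_module N_left_module \<sigma>_hom] that by blast
    ultimately have "f \<ominus>\<^bsub>D\<^esub> g \<in> K S"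
      using that(6) by (auto simp: K_def Z_def)
    then show ?thesis
      using mod_hom_eq_iff[OF dsum_left_module modQ p(1)] that ker[of "f \<ominus>\<^bsub>D\<^esub> g"] by simp
  qed
  have single: "single F x \<in> part (Pow G)" if "F \<subseteq> G" "G \<in> Fpow S" "x \<in> carrier (N F)" for F G x
    using that dsum_single_part[OF Fpow_subset[OF that(1,2)]] dsum_part_mono[of "{F}" "Pow G"] by blast
  show ?thesis
  proof
    show "orth Q" by (rule Q)
    have q_hom: "q F \<in> mod_hom R (N F) Q" if "F \<in> Fpow S" for F
      unfolding q_def by (rule mod_hom_comp[OF dsum_single_hom[OF that] p(1)])
    have "q G (\<tau> F G x) = q F x" if "F \<subseteq> G" "G \<in> Fpow S" "x \<in> carrier (N F)" for F G x
    proof -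
      note F = Fpow_subset[OF that(1,2)]
      note \<tau>x = \<tau>_closed[OF that]
      have "\<sigma> G (single F x) = \<tau> F G x"
        using \<tau>_\<sigma>[OF that(1,2) single[OF subset_refl F that(3)]] \<sigma>_single[OF F that(3)] by simp
      then show ?thesis
        unfolding q_def comp_def
        using p_eqI[of "single G (\<tau> F G x)" "single F x" G] \<sigma>_single[OF that(2) \<tau>x]
          dsum_single_closed[OF F that(3)] dsum_single_closed[OF that(2) \<tau>x]
          single[OF that] single[OF subset_refl that(2) \<tau>x] that(2)
        by simp
    qed
    with q_hom show "is_cocone Q q"
      by (simp add: is_cocone_def)
    have "\<exists>F\<in>Fpow S. z \<in> q F ` carrier (N F)" if z: "z \<in> carrier Q" for z
    proof -
      obtain f where f: "f \<in> carrier D" "z = p f" using z p(2) by auto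
      define F where "F = \<upsilon> f"
      have F: "F \<in> Fpow S" "f \<in> part (Pow F)" using \<upsilon>[OF f(1)] by (auto simp: F_def)
      note \<sigma>f = \<sigma>_closed[OF F(1) f(1)]
      have "p f = q F (\<sigma> F f)"
        unfolding q_def comp_def
        using p_eqI[of f "single F (\<sigma> F f)" F] f F single[OF subset_refl F(1) \<sigma>f]
          dsum_single_closed[OF F(1) \<sigma>f] \<sigma>_single[OF F(1) \<sigma>f]
        by simp
      then show ?thesis using f F \<sigma>f by blast
    qed
    then show "carrier Q = (\<Union>F\<in>Fpow S. q F ` carrier (N F))"
      using mod_hom_closed[OF q_hom] by auto
  next
    show "\<forall>(X :: ('r, 'u) module) c. left_module R X \<and> is_cocone X c \<longrightarrow>
      (\<exists>k\<in>mod_hom R Q X. \<forall>F\<in>Fpow S. \<forall>x\<in>carrier (N F). k (q F x) = c F x)"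
    proof (intro allI impI, elim conjE)
      fix X :: "('r, 'u) module" and c
      assume X: "left_module R X" and "is_cocone X c"
      note c = is_coconeD(1)[OF this(2)] and c\<tau> = is_coconeD(2)[OF this(2)]
      interpret X: left_module R X by (rule X)
      \<comment> \<open>Each \<open>f\<close> is evaluated at its own stage, and the next claim
        shows that every later stage gives the same value. Additivity can then be checked at a
        common stage.\<close>
      define \<pi> where "\<pi> f = c (\<upsilon> f) (\<sigma> (\<upsilon> f) f)" for f
      have \<pi>: "\<pi> f = c F (\<sigma> F f)" if "F \<in> Fpow S" "f \<in> part (Pow F)" for F f
      proof -
        have fD: "f \<in> carrier D" using that dsum_part_subset by blast
        note u = \<upsilon>[OF fD] \<upsilon>_least[OF that(2)]
        have "c F (\<sigma> F f) = c F (\<tau> (\<upsilon> f) F (\<sigma> (\<upsilon> f) f))"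
          using \<tau>_\<sigma>[OF u(3) that(1) u(2)] by simp
        also have "\<dots> = \<pi> f"
          unfolding \<pi>_def by (rule c\<tau>[OF u(3) that(1) \<sigma>_closed[OF u(1) fD]])
        finally show ?thesis by simp
      qed
      have "\<pi> \<in> mod_hom R D X"
      proof (rule mod_homI)
        show "\<pi> f \<in> carrier X" if "f \<in> carrier D" for f
          unfolding \<pi>_def using that by (intro mod_hom_closed[OF c] \<sigma>_closed \<upsilon>)
      next
        fix f g assume fg: "f \<in> carrier D" "g \<in> carrier D"
        define F where "F = \<upsilon> f \<union> \<upsilon> g"
        have F: "F \<in> Fpow S" "f \<in> part (Pow F)" "g \<in> part (Pow F)"
          using Fpow_Un[OF \<upsilon>(1)[OF fg(1)] \<upsilon>(1)[OF fg(2)]] part_Un[OF \<upsilon>(2)[OF fg(1)] \<upsilon>(2)[OF fg(2)]]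
          by (simp_all add: F_def)
        then show "\<pi> (f \<oplus>\<^bsub>D\<^esub> g) = \<pi> f \<oplus>\<^bsub>X\<^esub> \<pi> g"
          using fg D.submodule_add[OF dsum_part_submodule]
          by (simp add: \<pi>[of F] mod_hom_add[OF \<sigma>_hom] mod_hom_add[OF c] \<sigma>_closed)
      next
        fix a f assume af: "a \<in> carrier R" "f \<in> carrier D"
        define F where "F = \<upsilon> f"
        have "F \<in> Fpow S" "f \<in> part (Pow F)"
          using \<upsilon> af by (auto simp: F_def)
        then show "\<pi> (a \<odot>\<^bsub>D\<^esub> f) = a \<odot>\<^bsub>X\<^esub> \<pi> f"
          using af D.submodule_smult[OF dsum_part_submodule]
          by (simp add: \<pi>[of F] mod_hom_smult[OF \<sigma>_hom] mod_hom_smult[OF c] \<sigma>_closed)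
      qed
      moreover have "\<pi> f = \<zero>\<^bsub>X\<^esub>" if f: "f \<in> carrier D" "p f = \<zero>\<^bsub>Q\<^esub>" for f
      proof -
        obtain F where F: "F \<in> Fpow S" "f \<in> part (Pow F)" "\<sigma> F f = \<zero>\<^bsub>N F\<^esub>"
          using ker f by (auto simp: K_def Z_def)
        then show ?thesis
          using \<pi> mod_hom_zero[OF N_left_module X c] by simp
      qed
      ultimately obtain k where k: "k \<in> mod_hom R Q X" "\<And>f. f \<in> carrier D \<Longrightarrow> k (p f) = \<pi> f"
        using mod_hom_factor[OF dsum_left_module modQ X p] by blast
      have "k (q F x) = c F x" if "F \<in> Fpow S" "x \<in> carrier (N F)" for F x
        using k(2)[OF dsum_single_closed[OF that]] \<pi>[OF that(1) single[OF subset_refl that]] \<sigma>_single[OF that]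
        by (simp add: q_def)
      with k(1) show "\<exists>k\<in>mod_hom R Q X. \<forall>F\<in>Fpow S. \<forall>x\<in>carrier (N F). k (q F x) = c F x"
        by blast
    qed
  qed
qed

end

section \<open>Arbitrary directed posets\<close>

lemma directed_poset_upper_bound:
  assumes "directed_poset I r" "finite A" "A \<subseteq> I"
  obtains k where "k \<in> I" "\<And>a. a \<in> A \<Longrightarrow> (a, k) \<in> r"
proof -
  have trans: "trans r"
    using assms(1) by (auto simp: directed_poset_def partial_order_on_def preorder_on_def)
  have "\<exists>k\<in>I. \<forall>a\<in>A. (a, k) \<in> r"
    using assms(2,3)
  proof (induction A rule: finite_induct)
    case empty
    then show ?case using assms(1) by (auto simp: directed_poset_def)
  next
    case (insert a A)
    then obtain k where k: "k \<in> I" "\<forall>a\<in>A. (a, k) \<in> r" by auto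
    then obtain m where "m \<in> I" "(k, m) \<in> r" "(a, m) \<in> r"
      using assms(1) insert.prems unfolding directed_poset_def by (metis insert_subset)
    with k transD[OF trans] show ?case by (intro bexI[of _ m]) blast+
  qed
  with that show ?thesis by blast
qed

text \<open>Well-founded recursion over finite sets: \<open>u F\<close> bounds the members of
  \<open>F\<close> and all earlier values \<open>u G\<close>. A finite set has finitely many
  subsets, so directedness supplies a bound.\<close>

lemma directed_poset_monotone_bounds:
  assumes "directed_poset I r"
  obtains u where "\<And>F. F \<in> Fpow I \<Longrightarrow> u F \<in> I" "\<And>F i. \<lbrakk>F \<in> Fpow I; i \<in> F\<rbrakk> \<Longrightarrow> (i, u F) \<in> r"
    "\<And>F G. \<lbrakk>F \<in> Fpow I; G \<subseteq> F\<rbrakk> \<Longrightarrow> (u G, u F) \<in> r"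
proof -
  define P where "P u F k \<longleftrightarrow> (F \<in> Fpow I \<longrightarrow>
      k \<in> I \<and> (\<forall>i\<in>F. (i, k) \<in> r) \<and> (\<forall>G. G \<subset> F \<longrightarrow> (u G, k) \<in> r))" for u :: "'a set \<Rightarrow> 'a" and F k
  \<comment> \<open>\<open>P u F\<close> reads \<open>u\<close> only at proper subsets of
    \<open>F\<close>, which is the locality required for dependent choice along
    \<open>finite_psubset\<close>. Outside \<open>Fpow I\<close> the condition is vacuous.\<close>
  have "\<exists>u. \<forall>F. P u F (u F)"
  proof (rule dependent_wf_choice[OF wf_finite_psubset])
    fix u v :: "'a set \<Rightarrow> 'a" and F k
    assume "\<And>G. (G, F) \<in> finite_psubset \<Longrightarrow> u G = v G"
    then show "P u F k = P v F k"
      by (auto simp: P_def Fpow_def)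
  next
    fix F and u :: "'a set \<Rightarrow> 'a"
    assume IH: "\<And>G. (G, F) \<in> finite_psubset \<Longrightarrow> P u G (u G)"
    show "\<exists>k. P u F k"
    proof (cases "F \<in> Fpow I")
      case True
      have "u G \<in> I" if "G \<subset> F" for G
        using IH[of G] that True by (auto simp: P_def Fpow_def dest: finite_subset)
      then have "finite (F \<union> u ` {G. G \<subset> F})" "F \<union> u ` {G. G \<subset> F} \<subseteq> I"
        using True finite_subset[of "{G. G \<subset> F}" "Pow F"] by (auto simp: Fpow_def)
      then obtain k where "k \<in> I" "\<And>a. a \<in> F \<union> u ` {G. G \<subset> F} \<Longrightarrow> (a, k) \<in> r"
        using directed_poset_upper_bound[OF assms] by metis
      then have "P u F k" by (auto simp: P_def)
      then show ?thesis ..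
    qed (auto simp: P_def)
  qed
  then obtain u where u: "\<And>F. P u F (u F)" by blast
  show ?thesis
  proof
    show "u F \<in> I" if "F \<in> Fpow I" for F
      using u[of F] that by (simp add: P_def)
    show "(i, u F) \<in> r" if "F \<in> Fpow I" "i \<in> F" for F i
      using u[of F] that by (simp add: P_def)
    show "(u G, u F) \<in> r" if "F \<in> Fpow I" "G \<subseteq> F" for F G
    proof (cases "G = F")
      case True
      have "u F \<in> I" using u[of F] that by (simp add: P_def)
      then show ?thesis
        using True assms
        by (auto simp: directed_poset_def partial_order_on_def preorder_on_def refl_on_def)
    next
      case False
      with that show ?thesis using u[of F] by (auto simp: P_def)
    qed
  qed
qed

theorem proposition3p1:
  fixes small :: "'u set \<Rightarrow> bool"
    and R :: "'r ring"
    and \<W> \<F> :: "('r, 'u) module set"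
    and I :: "'i set" and r :: "'i rel"
    and M :: "'i \<Rightarrow> ('r, 'u) module" and t :: "'i \<Rightarrow> 'i \<Rightarrow> 'u \<Rightarrow> 'u"
    and L :: "('r, 'u) module" and l :: "'i \<Rightarrow> 'u \<Rightarrow> 'u"
  assumes "smallness small"
    and "ring R" and "of_small_size small (carrier R)"
    and "cotorsion_pair small R \<W> \<F>"
    and "thick small R \<W>"
    and "directed_poset I r" and "of_small_size small I"
    and "direct_system small R I r M t"
    and "\<And>i. i \<in> I \<Longrightarrow> M i \<in> \<W>"
    and "is_colimit small R I r M t L l"
  shows "L \<in> \<W>"
proof -
  interpret T: thick_cotorsion_pair small R \<W> \<F>
    using assms(1,4,5) by (intro thick_cotorsion_pair.intro thick_cotorsion_pair_axioms.intro)
  obtain u where u: "\<And>F. F \<in> Fpow I \<Longrightarrow> u F \<in> I" "\<And>F i. \<lbrakk>F \<in> Fpow I; i \<in> F\<rbrakk> \<Longrightarrow> (i, u F) \<in> r"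
    "\<And>F G. \<lbrakk>F \<in> Fpow I; G \<subseteq> F\<rbrakk> \<Longrightarrow> (u G, u F) \<in> r"
    using directed_poset_monotone_bounds[OF assms(6)] by blast
  have dom: "i \<in> I" "j \<in> I" if "(i, j) \<in> r" for i j
    using assms(6) that by (auto simp: directed_poset_def partial_order_on_def preorder_on_def)
  have t_hom: "t i j \<in> mod_hom R (M i) (M j)" if "(i, j) \<in> r" for i j
    using assms(8) that by (auto simp: direct_system_def)
  have t_id: "t i i x = x" if "i \<in> I" "x \<in> carrier (M i)" for i x
    using assms(8) that by (auto simp: direct_system_def)
  have t_comp: "t j k (t i j x) = t i k x" if "(i, j) \<in> r" "(j, k) \<in> r" "x \<in> carrier (M i)" for i j k x
    using assms(8) that unfolding direct_system_def by blast
  interpret S: finite_subset_system small R \<W> \<F> I "\<lambda>F. M (u F)" "\<lambda>F G. t (u F) (u G)"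
    by (intro finite_subset_system.intro T.thick_cotorsion_pair_axioms finite_subset_system_axioms.intro)
      (simp_all add: assms(2,7,9) u t_hom t_id t_comp Fpow_subset)
  obtain Q :: "('r, 'i set \<Rightarrow> 'u) module" and q where Q: "T.orth Q" and q: "S.is_cocone Q q"
    and q_surj: "carrier Q = (\<Union>F\<in>Fpow I. q F ` carrier (M (u F)))"
    and q_univ: "\<forall>(X :: ('r, 'u) module) c. left_module R X \<and> S.is_cocone X c \<longrightarrow>
      (\<exists>k\<in>mod_hom R Q X. \<forall>F\<in>Fpow I. \<forall>x\<in>carrier (M (u F)). k (q F x) = c F x)"
    by (rule S.ex_orth_direct_limit)
  note q_hom = S.is_coconeD(1)[OF q] and q_comp = S.is_coconeD(2)[OF q]
  note modQ = T.orthD(1)[OF Q]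
  \<comment> \<open>The colimit property of \<open>L\<close> tests only modules on
    \<open>'u\<close>, so \<open>Q\<close> is first copied there.\<close>
  obtain Q' \<phi> where Q': "Q' \<in> RMod small R" and \<phi>: "\<phi> \<in> mod_hom R Q Q'" "bij_betw \<phi> (carrier Q) (carrier Q')"
    using T.ex_iso_RMod[OF T.orthD[OF Q]] .
  have modQ': "left_module R Q'" using Q' by (simp add: RMod_def)
  define \<psi> where "\<psi> = inv_into (carrier Q) \<phi>"
  have \<psi>: "\<psi> \<in> mod_hom R Q' Q"
    unfolding \<psi>_def by (rule mod_hom_inverse[OF modQ \<phi>])
  have \<psi>\<phi>: "\<psi> (\<phi> z) = z" if "z \<in> carrier Q" for z
    using \<phi>(2) that by (simp add: \<psi>_def bij_betw_def)
  have single: "{i} \<in> Fpow I" if "i \<in> I" for i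
    using that by (simp add: Fpow_def)
  have sing: "(i, u {i}) \<in> r" if "i \<in> I" for i
    using u(2)[OF single[OF that]] by simp
  \<comment> \<open>Index \<open>i\<close> enters the new system at the singleton, since
    \<open>i\<close> lies below \<open>u {i}\<close>. The next claim allows any finite
    \<open>G\<close> containing \<open>i\<close> instead, so that legs with different indices can be
    compared at a common stage.\<close>
  define c where "c i = \<phi> \<circ> q {i} \<circ> t i (u {i})" for i
  have c_q: "c i x = \<phi> (q G (t i (u G) x))" if "i \<in> G" "G \<in> Fpow I" "x \<in> carrier (M i)" for i G x
  proof -
    have i: "i \<in> I" using that by (auto simp: Fpow_def)
    have sub: "{i} \<subseteq> G" using that by simp
    have "q {i} (t i (u {i}) x) = q G (t (u {i}) (u G) (t i (u {i}) x))"
      using q_comp[OF sub that(2)] mod_hom_closed[OF t_hom[OF sing[OF i]] that(3)] by simp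
    then show ?thesis
      using t_comp[OF sing[OF i] u(3)[OF that(2) sub] that(3)] by (simp add: c_def)
  qed
  have "cocone small R I r M t Q' c"
    unfolding cocone_def
  proof (intro conjI ballI)
    show "c i \<in> mod_hom R (M i) Q'" if "i \<in> I" for i
      unfolding c_def by (intro mod_hom_comp[OF t_hom[OF sing[OF that]]] mod_hom_comp[OF q_hom[OF single[OF that]] \<phi>(1)])
    fix e assume e: "e \<in> r"
    obtain i j where ij: "e = (i, j)" by (cases e)
    then have r: "(i, j) \<in> r" using e by simp
    have G: "{i, j} \<in> Fpow I" using dom[OF r] by (simp add: Fpow_def)
    have "c j (t i j x) = c i x" if x: "x \<in> carrier (M i)" for x
    proof -
      have "c j (t i j x) = \<phi> (q {i, j} (t j (u {i, j}) (t i j x)))"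
        using mod_hom_closed[OF t_hom[OF r] x] by (intro c_q G) auto
      also have "t j (u {i, j}) (t i j x) = t i (u {i, j}) x"
        using u(2)[OF G] by (intro t_comp r x) simp
      also have "\<phi> (q {i, j} (t i (u {i, j}) x)) = c i x"
        by (intro c_q[symmetric] G x) simp
      finally show ?thesis .
    qed
    then show "case e of (i, j) \<Rightarrow> \<forall>x\<in>carrier (M i). c j (t i j x) = c i x"
      by (simp add: ij)
  qed (rule Q')
  then obtain h where h: "h \<in> mod_hom R L Q'" "\<And>i x. \<lbrakk>i \<in> I; x \<in> carrier (M i)\<rbrakk> \<Longrightarrow> h (l i x) = c i x"
    using assms(10) unfolding is_colimit_def by blast
  have L: "cocone small R I r M t L l" using assms(10) by (simp add: is_colimit_def)
  have RModL: "L \<in> RMod small R" and l_hom: "\<And>i. i \<in> I \<Longrightarrow> l i \<in> mod_hom R (M i) L"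
    and l_comp: "\<And>i j x. \<lbrakk>(i, j) \<in> r; x \<in> carrier (M i)\<rbrakk> \<Longrightarrow> l j (t i j x) = l i x"
    using L by (auto simp: cocone_def)
  have modL: "left_module R L" using RModL by (simp add: RMod_def)
  obtain k where k: "k \<in> mod_hom R Q L" "\<And>F x. \<lbrakk>F \<in> Fpow I; x \<in> carrier (M (u F))\<rbrakk> \<Longrightarrow> k (q F x) = l (u F) x"
  proof -
    have "S.is_cocone L (\<lambda>F. l (u F))"
      using l_hom l_comp u by (simp add: S.is_cocone_def)
    with q_univ modL that show ?thesis by blast
  qed
  define k' where "k' = k \<circ> \<psi>"
  have k': "k' \<in> mod_hom R Q' L"
    unfolding k'_def by (rule mod_hom_comp[OF \<psi> k(1)])
  have k'h_l: "k' (h (l i x)) = l i x" if i: "i \<in> I" and x: "x \<in> carrier (M i)" for i x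
  proof -
    have tx: "t i (u {i}) x \<in> carrier (M (u {i}))"
      by (rule mod_hom_closed[OF t_hom[OF sing[OF i]] x])
    then have "k' (c i x) = l (u {i}) (t i (u {i}) x)"
      using k(2)[OF single[OF i]] \<psi>\<phi> mod_hom_closed[OF q_hom[OF single[OF i]]] by (simp add: k'_def c_def)
    then show ?thesis
      using h(2)[OF i x] l_comp[OF sing[OF i] x] by simp
  qed
  \<comment> \<open>Uniqueness of mediating maps is applied to endomorphisms of \<open>L\<close>:
    \<open>k' \<circ> h\<close> and the identity are both compatible with the legs
    \<open>l i\<close>, so both agree with \<open>h0\<close>.\<close>
  obtain h0 where h0: "\<forall>h'\<in>mod_hom R L L. (\<forall>i\<in>I. \<forall>x\<in>carrier (M i). h' (l i x) = l i x) \<longrightarrow>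
      (\<forall>y\<in>carrier L. h' y = h0 y)"
    using assms(10) L unfolding is_colimit_def by blast
  have "\<forall>y\<in>carrier L. (k' \<circ> h) y = h0 y"
    using h0[rule_format, OF mod_hom_comp[OF h(1) k']] k'h_l by simp
  moreover have "\<forall>y\<in>carrier L. y = h0 y"
    using h0[rule_format, of "\<lambda>y. y"] by (simp add: mod_homI)
  ultimately have k'h: "k' (h y) = y" if "y \<in> carrier L" for y
    using that by simp
  have hk': "h (k' y) = y" if y: "y \<in> carrier Q'" for y
  proof -
    obtain z where z: "z \<in> carrier Q" "y = \<phi> z"
      using \<phi>(2) y by (auto simp: bij_betw_def)
    obtain F x where F: "F \<in> Fpow I" "x \<in> carrier (M (u F))" "z = q F x"
      using q_surj z(1) by blast
    \<comment> \<open>\<open>G\<close> contains \<open>F\<close>, so that \<open>q F x\<close> can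
      be moved to stage \<open>G\<close>, and also the index \<open>u F\<close>, so that
      \<open>c (u F)\<close> can be evaluated there.\<close>
    define G where "G = insert (u F) F"
    have G: "G \<in> Fpow I" "F \<subseteq> G" "u F \<in> G"
      using F(1) u(1)[OF F(1)] by (auto simp: G_def Fpow_def)
    have "h (k' y) = c (u F) x"
      using F z \<psi>\<phi>[OF z(1)] k(2) h(2) u(1) by (simp add: k'_def)
    also have "\<dots> = \<phi> (q F x)"
      using c_q[OF G(3,1) F(2)] q_comp[OF G(2,1) F(2)] by simp
    finally show ?thesis
      using F z by simp
  qed
  have "bij_betw k' (carrier Q') (carrier L)"
    using k'h hk' mod_hom_closed[OF k'] mod_hom_closed[OF h(1)]
    by (intro bij_betw_byWitness[of _ h]) auto
  moreover have "T.orth Q'"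
    by (rule T.ext_orthogonal_iso[OF Q modQ' \<phi>])
  ultimately have "T.orth L"
    using T.ext_orthogonal_iso[OF _ modL k'] by blast
  then show ?thesis
    using T.orth_iff[OF RModL] by blast
qed

end
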